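(* Let $F$ be a vector subspace of $\mathcal B(S)$ satisfying conditions (i)–(vi) below, and assume (H1) below holds with a constant $\alpha\in\big(0,\sqrt[4]{8}/2\big)$. Let $f\in F$ with $(\mu,f)=0$. Then $\overline M^\pi_n(f)=n^{-1}\sum_{i=1}^nf(X_{\pi(i)})$ converges almost surely to $0$ as $n\to\infty$.
   Context: Binary tree: $\mathbb T=\mathbb N^*$, vertex $n$ having daughters $2n,2n+1$; $\mathbb G_r=\{2^r,\dots,2^{r+1}-1\}$, $\mathbb T_r=\bigcup_{q=0}^r\mathbb G_q$. $(S,\mathcal S)$ is a metric space with Borel $\sigma$-field; $\mathcal B(S^p)$ is the set of measurable real functions on $S^p$. A $\mathbb T$-transition probability $P$ is a Markov kernel from $S$ to $S^2$; $P_0(x,B)=P(x,B\times S)$, $P_1(x,B)=P(x,S\times B)$, $Q=(P_0+P_1)/2$; for $f,g\in\mathcal B(S)$, $(f\otimes g)(y,z)=f(y)g(z)$, $P(f\otimes g)(x)=\int f(y)g(z)P(x,dy\,dz)$. $(X_n)_{n\in\mathbb T}$ is a bifurcating Markov chain with initial law $\nu$ and $\mathbb T$-transition probability $P$: with $\mathcal F_r=\sigma(X_i,i\in\mathbb T_r)$, $\mathcal L(X_1)=\nu$ and for every $r$ and every family $(f_n)_{n\in\mathbb G_r}$ of bounded measurable functions on $S^3$, $\mathbb E[\prod_{n\in\mathbb G_r}f_n(X_n,X_{2n},X_{2n+1})\mid\mathcal F_r]=\prod_{n\in\mathbb G_r}Pf_n(X_n)$ where $Pf(x)=\int f(x,y,z)P(x,dy\,dz)$.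 $(Y_r)$ is a Markov chain on $S$ with transition $Q$ ($\mathbb E_x$: $Y_0=x$). $\pi$ is a random permutation of $\mathbb N^*$ leaving each $\mathbb G_r$ invariant, drawn uniformly among such permutations, independently of $X$. $(\mu,f)=\int fd\mu$. Conditions on $F$: (i) $F$ contains constants; (ii) $f^2\in F$ for $f\in F$; (iii) for all $x$ and $f,g\in F$, $f\otimes g\in L^1(P(x,\cdot))$ and $P(f\otimes g)\in F$; (iv) there is a probability $\mu$ on $S$ with $F\subset L^1(\mu)$ and $\lim_r\mathbb E_x[f(Y_r)]=(\mu,f)$ for all $x$, $f\in F$; (v) for every $f\in F$ there is $g\in F$ with $|Q^rf|\le g$ for all $r$; (vi) $F\subset L^1(\nu)$. (H1): there is $\alpha\in(0,1)$ such that for every $f\in F$ with $(\mu,f)=0$ there is $g\in F$ with $|Q^rf(x)|\le\alpha^rg(x)$ for all $r,x$. *)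

theory Defs
  imports "HOL-Probability.Probability" "HOL-Combinatorics.Permutations"
begin

definition Gen :: "nat \<Rightarrow> nat set" where
  "Gen r = {2^r ..< 2^(Suc r)}"

definition Tr :: "nat \<Rightarrow> nat set" where
  "Tr r = (\<Union>q\<le>r. Gen q)"

definition Qker :: "('s::metric_space \<Rightarrow> ('s \<times> 's) measure) \<Rightarrow> 's \<Rightarrow> 's measure" where
  "Qker P x = measure_of (space borel) (sets borel)
      (\<lambda>B. (emeasure (P x) (B \<times> UNIV) + emeasure (P x) (UNIV \<times> B)) / 2)"

primrec Qn :: "('s::metric_space \<Rightarrow> ('s \<times> 's) measure) \<Rightarrow> nat \<Rightarrow> 's \<Rightarrow> 's measure" where
  "Qn P 0 x = return borel x"
| "Qn P (Suc r) x = bind (Qn P r x) (Qker P)"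

definition Qpow :: "('s::metric_space \<Rightarrow> ('s \<times> 's) measure) \<Rightarrow> nat \<Rightarrow> ('s \<Rightarrow> real) \<Rightarrow> 's \<Rightarrow> real" where
  "Qpow P r f x = (\<integral>y. f y \<partial>(Qn P r x))"

definition Filt :: "'w measure \<Rightarrow> (nat \<Rightarrow> 'w \<Rightarrow> 's::metric_space) \<Rightarrow> nat \<Rightarrow> 'w measure" where
  "Filt M X r = sigma (space M) {X i -` A \<inter> space M | i A. i \<in> Tr r \<and> A \<in> sets borel}"

definition is_BMC :: "'w measure \<Rightarrow> (nat \<Rightarrow> 'w \<Rightarrow> 's::metric_space) \<Rightarrow> 's measure
    \<Rightarrow> ('s \<Rightarrow> ('s \<times> 's) measure) \<Rightarrow> bool" where
  "is_BMC M X \<nu> P \<longleftrightarrow>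
     (\<forall>n. X n \<in> M \<rightarrow>\<^sub>M borel) \<and> distr M borel (X 1) = \<nu> \<and>
     (\<forall>r (fs :: nat \<Rightarrow> 's \<times> 's \<times> 's \<Rightarrow> real).
        (\<forall>n\<in>Gen r. fs n \<in> borel_measurable (borel \<Otimes>\<^sub>M borel \<Otimes>\<^sub>M borel) \<and>
                    (\<exists>B. \<forall>t. \<bar>fs n t\<bar> \<le> B)) \<longrightarrow>
        (AE \<omega> in M. real_cond_exp M (Filt M X r)
              (\<lambda>\<omega>. \<Prod>n\<in>Gen r. fs n (X n \<omega>, X (2*n) \<omega>, X (2*n+1) \<omega>)) \<omega>
           = (\<Prod>n\<in>Gen r. \<integral>yz. fs n (X n \<omega>, fst yz, snd yz) \<partial>(P (X n \<omega>)))))"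

definition levperms :: "nat \<Rightarrow> (nat \<Rightarrow> nat) set" where
  "levperms R = {\<sigma>. \<sigma> permutes Tr R \<and> (\<forall>q\<le>R. \<sigma> ` Gen q = Gen q)}"

text \<open>pi is a random permutation of N* leaving each G_r invariant, uniformly distributed
  among such permutations (the law is determined by its restrictions to the finite sets T_R,
  each of which is uniform), and independent of X.\<close>
definition is_unif_level_perm :: "'w measure \<Rightarrow> ('w \<Rightarrow> nat \<Rightarrow> nat) \<Rightarrow> bool" where
  "is_unif_level_perm M \<pi> \<longleftrightarrow>
     (\<forall>i. (\<lambda>\<omega>. \<pi> \<omega> i) \<in> M \<rightarrow>\<^sub>M count_space UNIV) \<and>
     (\<forall>\<omega>\<in>space M. \<pi> \<omega> permutes {0<..} \<and> (\<forall>r. \<pi> \<omega> ` Gen r = Gen r)) \<and>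
     (\<forall>R. \<forall>\<sigma>\<in>levperms R.
        measure M {\<omega>\<in>space M. \<forall>i\<in>Tr R. \<pi> \<omega> i = \<sigma> i} = 1 / real (card (levperms R)))"

end

theory Submission
  imports Defs
begin

text \<open>
  Write \<open>T\<^sub>r(f)\<close> for the sum of \<open>f(X\<^sub>n)\<close> over the generation \<open>Gen r\<close>. Conditioning on generation
  \<open>r\<close>, where distinct mothers have independent offspring, gives
  \<open>E[T\<^sub>r\<^sub>+\<^sub>1(f)\<^sup>2] \<le> 4 E[T\<^sub>r(Qf)\<^sup>2] + 4 E[T\<^sub>r(Q(f\<^sup>2))]\<close>; iterating, (H1) yields
  \<open>E[T\<^sub>r(f)\<^sup>2] = O(4\<^sup>r b\<^sup>r)\<close> for every \<open>b > max(\<alpha>\<^sup>2, 1/2)\<close>, and the bound on \<open>\<alpha>\<close> allows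
  \<open>b < 1/\<surd>2\<close>. Sampling a generation without replacement, a partial sum has second moment at most
  \<open>E[T\<^sub>r(f\<^sup>2)] + E[T\<^sub>r(f)\<^sup>2]\<close>. Applying this at the multiples of \<open>2^(r div 2)\<close> only, about
  \<open>2^(r/2)\<close> points, the normalized second moments are summable over \<open>r\<close>, and the increments between
  neighbouring points are small by the Cauchy-Schwarz inequality.
\<close>

subsection \<open>Averages over dyadic generations\<close>

text \<open>The fourth power of the bound on \<alpha> is \<open>8/16 = 1/2\<close>, so it means
  \<alpha>^2 < 1/sqrt 2. This threshold is the price of a union over grid points: about
  \<open>2^(r/2)\<close> partial sums, each with second moment of order
  \<open>2^r + 4^r b^r\<close>, divided by \<open>4^r\<close>, leave
  \<open>2^(-r/2) + (sqrt 2 b)^r\<close>, summable exactly when \<open>b < 1/sqrt 2\<close>. The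
  mesh balances this: filling the gaps costs mesh times \<open>2^r\<close>, again
  \<open>2^(-r/2)\<close> after division by \<open>4^r\<close>, whereas a union over all
  \<open>2^r\<close> positions would not even make the part \<open>2^r / 4^r\<close> summable. The
  randomness of \<pi> enters through the joint law of two of its values in one generation, because
  only second moments are taken. The obstacle is that the defining property of the chain speaks of
  bounded functions, while those in \<open>F\<close> may be unbounded. For one mother this is met by
  nonnegative integrals, for two mothers by truncation and dominated convergence, with dominating
  functions built inside \<open>F\<close> from squares and constants.\<close>

lemma Gen_eq: "Gen r = {2^r..<2^r + 2^r}"
  by (simp add: Gen_def mult_2)

lemma finite_Gen [simp, intro]: "finite (Gen r)"
  by (simp add: Gen_def)

lemma Gen_0 [simp]: "Gen 0 = {1}"
  by (auto simp: Gen_def)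

text \<open>Groups a generation by mothers, because the transition law describes two sisters
  jointly.\<close>

lemma sum_Gen_Suc:
  fixes h :: "nat \<Rightarrow> 'a::comm_monoid_add"
  shows "(\<Sum>n\<in>Gen (Suc r). h n) = (\<Sum>n\<in>Gen r. h (2*n) + h (2*n+1))"
proof -
  have split: "Gen (Suc r) = (*) 2 ` Gen r \<union> (\<lambda>n. 2*n+1) ` Gen r" (is "_ = ?A \<union> ?B")
  proof
    show "?A \<union> ?B \<subseteq> Gen (Suc r)"
      by (auto simp: Gen_def)
    show "Gen (Suc r) \<subseteq> ?A \<union> ?B"
    proof
      fix m assume m: "m \<in> Gen (Suc r)"
      then have "m div 2 \<in> Gen r"
        by (auto simp: Gen_def)
      moreover have "m = 2 * (m div 2) \<or> m = 2 * (m div 2) + 1"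
        by arith
      ultimately show "m \<in> ?A \<union> ?B"
        by blast
    qed
  qed
  have "?A \<inter> ?B = {}"
    by (auto, arith)
  then have "(\<Sum>n\<in>Gen (Suc r). h n) = sum h ?A + sum h ?B"
    unfolding split by (intro sum.union_disjoint) auto
  also have "\<dots> = (\<Sum>n\<in>Gen r. h (2*n)) + (\<Sum>n\<in>Gen r. h (2*n+1))"
    by (simp add: sum.reindex inj_on_def)
  finally show ?thesis
    by (simp add: sum.distrib)
qed

text \<open>An index \<open>n\<close> in generation \<open>r\<close> is at least \<open>2^r\<close>,
  so an error \<open>o(2^r)\<close> in the current generation is negligible; the errors of the
  completed generations form a geometric sum of the same order.\<close>

lemma dyadic_average_tendsto_zero:
  fixes v s :: "nat \<Rightarrow> real"
  assumes s: "s \<longlonglongrightarrow> 0"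
    and le: "\<And>r k. k \<le> 2^r \<Longrightarrow> \<bar>\<Sum>i\<in>{2^r..<2^r+k}. v i\<bar> \<le> 2^r * s r"
  shows "(\<lambda>n. (\<Sum>i=1..n. v i) / real n) \<longlonglongrightarrow> 0"
proof (rule LIMSEQ_I)
  fix e :: real assume e: "0 < e"
  \<comment> \<open>One quarter each for the initial block, the completed generations and the
    current one; the last is slack.\<close>
  define d where "d = e / 4"
  have d: "0 < d" using e by (simp add: d_def)
  obtain q where q: "\<And>r. r \<ge> q \<Longrightarrow> s r \<le> d"
    using order_tendstoD(2)[OF s d] unfolding eventually_sequentially by (meson less_imp_le)
  define B where "B = \<bar>\<Sum>i\<in>{1..<2^q}. v i\<bar>"
  \<comment> \<open>The form \<open>B + d * 2^r\<close> reproduces itself: generation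
    \<open>r\<close> adds another \<open>d * 2^r\<close>.\<close>
  have full: "\<bar>\<Sum>i\<in>{1..<2^r}. v i\<bar> \<le> B + d * 2^r" if "r \<ge> q" for r
    using that
  proof (induction r rule: dec_induct)
    case base
    show ?case using d by (simp add: B_def)
  next
    case (step r)
    have "{1..<2^Suc r} = {1..<2^r} \<union> {2^r..<2^r+2^r::nat}"
      by (subst ivl_disj_un) auto
    then have "(\<Sum>i\<in>{1..<2^Suc r}. v i) = (\<Sum>i\<in>{1..<2^r}. v i) + (\<Sum>i\<in>{2^r..<2^r+2^r}. v i)"
      by (simp add: sum.union_disjoint)
    moreover have "2^r * s r \<le> 2^r * d"
      using q[of r] step by simp
    ultimately have "\<bar>\<Sum>i\<in>{1..<2^Suc r}. v i\<bar> \<le> (B + d * 2^r) + 2^r * d"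
      using step.IH le[of "2^r" r] by linarith
    then show ?case
      by (simp add: algebra_simps)
  qed
  have bound: "\<bar>\<Sum>i=1..n. v i\<bar> \<le> B + 2 * d * n" if n: "n \<ge> 2^q" for n :: nat
  proof -
    have "0 < n" using n by (rule less_le_trans[rotated]) simp
    then obtain r where r: "2^r \<le> n" "n < 2^Suc r"
      using ex_power_ivl1[of 2 n] by auto
    have "(2::nat)^q < 2^Suc r" using n r by linarith
    then have "q \<le> r" by (simp add: power_strict_increasing_iff del: power_Suc)
    \<comment> \<open>\<open>Suc n\<close> because the sum includes \<open>n\<close>, while the
      blocks are half open.\<close>
    define k where "k = Suc n - 2^r"
    have k: "k \<le> 2^r" "2^r + k = Suc n" using r by (auto simp: k_def)
    have "{1..n} = {1..<2^r} \<union> {2^r..<2^r+k}"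
      using k r by auto
    then have "(\<Sum>i=1..n. v i) = (\<Sum>i\<in>{1..<2^r}. v i) + (\<Sum>i\<in>{2^r..<2^r+k}. v i)"
      by (simp add: sum.union_disjoint)
    moreover have "2^r * s r \<le> 2^r * d"
      using q[OF \<open>q \<le> r\<close>] by simp
    ultimately have "\<bar>\<Sum>i=1..n. v i\<bar> \<le> (B + d * 2^r) + 2^r * d"
      using full[OF \<open>q \<le> r\<close>] le[OF k(1)] by linarith
    also have "\<dots> = B + 2 * d * 2^r"
      by simp
    also have "\<dots> \<le> B + 2 * d * n"
    proof -
      have "real (2^r) \<le> real n" using r(1) by (rule of_nat_mono)
      then show ?thesis using d by simp
    qed
    finally show ?thesis .
  qed
  obtain m :: nat where m: "B / d < m" using reals_Archimedean2 by blast
  show "\<exists>no. \<forall>n\<ge>no. norm ((\<Sum>i=1..n. v i) / real n - 0) < e"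
  proof (intro exI allI impI)
    fix n assume n: "n \<ge> max (max m (2^q)) 1"
    then have pos: "0 < real n" by simp
    have "B < d * m" using m d by (simp add: field_simps)
    also have "\<dots> \<le> d * n" using n d by simp
    finally have "\<bar>\<Sum>i=1..n. v i\<bar> < 4 * d * n"
      using bound[of n] n d pos by (simp add: algebra_simps)
    then show "norm ((\<Sum>i=1..n. v i) / real n - 0) < e"
      using pos by (simp add: d_def field_simps)
  qed
qed

text \<open>Instead of a maximal inequality: partial sums are controlled on a grid of mesh \<open>b\<close>, and the
  Cauchy-Schwarz inequality fills the gaps.\<close>

lemma partial_sum_square_le_grid:
  fixes v :: "nat \<Rightarrow> real"
  assumes k: "k \<le> b * c" and b: "0 < b"
  shows "(\<Sum>i\<in>{N..<N+k}. v i)\<^sup>2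
    \<le> 2 * (\<Sum>j\<le>c. (\<Sum>i\<in>{N..<N+j*b}. v i)\<^sup>2) + 2 * b * (\<Sum>i\<in>{N..<N+b*c}. (v i)\<^sup>2)"
proof -
  \<comment> \<open>The last grid point not beyond \<open>k\<close> is \<open>j * b\<close>; at most
    \<open>b\<close> terms remain.\<close>
  define j where "j = k div b"
  have j: "j \<le> c"
    using div_le_mono[OF k, of b] b by (simp add: j_def)
  have jk: "j * b \<le> k" "k \<le> j * b + b"
    using mod_less_divisor[OF b, of k] div_mult_mod_eq[of k b] unfolding j_def by linarith+
  define S where "S = (\<Sum>i\<in>{N..<N+j*b}. v i)"
  define D where "D = (\<Sum>i\<in>{N+j*b..<N+k}. v i)"
  have SD: "(\<Sum>i\<in>{N..<N+k}. v i) = S + D"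
    unfolding S_def D_def by (subst sum.atLeastLessThan_concat) (use jk in auto)
  have "D\<^sup>2 \<le> (\<Sum>i\<in>{N+j*b..<N+k}. (v i)\<^sup>2) * real (card {N+j*b..<N+k})"
    unfolding D_def by (rule sum_squared_le_sum_of_squares)
  also have "\<dots> \<le> (\<Sum>i\<in>{N..<N+b*c}. (v i)\<^sup>2) * b"
    using jk k by (intro mult_mono sum_mono2 of_nat_mono sum_nonneg of_nat_0_le_iff) auto
  finally have D: "D\<^sup>2 \<le> b * (\<Sum>i\<in>{N..<N+b*c}. (v i)\<^sup>2)"
    by (simp add: mult.commute)
  \<comment> \<open>Passing from one square to the sum of all removes the dependence on
    \<open>k\<close>, so the bound serves all partial sums at once.\<close>
  have S: "S\<^sup>2 \<le> (\<Sum>j\<le>c. (\<Sum>i\<in>{N..<N+j*b}. v i)\<^sup>2)"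
    unfolding S_def using j by (intro member_le_sum) auto
  have "(S + D)\<^sup>2 \<le> 2 * S\<^sup>2 + 2 * D\<^sup>2"
    using zero_le_power2[of "S - D"] by (simp add: power2_eq_square algebra_simps)
  with S D SD show ?thesis by (simp add: algebra_simps)
qed

section \<open>Two tools from probability: independence and almost sure convergence\<close>

text \<open>Turns independence of families of events, the form in which it is assumed of \<pi> and
  the chain, into independence of real random variables, for which expectations of products
  factor.\<close>

lemma (in prob_space) indep_var_if_indep_set_vimage:
  fixes g :: "'b \<Rightarrow> real" and h :: "'c \<Rightarrow> real"
  assumes indep: "indep_set {U -` A \<inter> space M | A. A \<in> sets S} {V -` B \<inter> space M | B. B \<in> sets T}"
    and [measurable]: "U \<in> M \<rightarrow>\<^sub>M S" "V \<in> M \<rightarrow>\<^sub>M T"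
    and g [measurable]: "g \<in> borel_measurable S" and h [measurable]: "h \<in> borel_measurable T"
  shows "indep_var borel (\<lambda>\<omega>. g (U \<omega>)) borel (\<lambda>\<omega>. h (V \<omega>))"
  unfolding indep_var_eq
proof (intro conjI indep_set_sigma_sets)
  let ?A = "{(\<lambda>\<omega>. g (U \<omega>)) -` A \<inter> space M | A. A \<in> sets borel}"
  let ?B = "{(\<lambda>\<omega>. h (V \<omega>)) -` B \<inter> space M | B. B \<in> sets borel}"
  \<comment> \<open>Independence extends to the generated sigma-fields only from families stable
    under intersection.\<close>
  have "Int_stable {Y -` A \<inter> space M | A. A \<in> sets borel}" for Y :: "'a \<Rightarrow> real"
  proof (rule Int_stableI)
    fix a b assume "a \<in> {Y -` A \<inter> space M | A. A \<in> sets borel}" "b \<in> {Y -` A \<inter> space M | A. A \<in> sets borel}"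
    then obtain A B where "A \<in> sets borel" "B \<in> sets borel" and ab: "a = Y -` A \<inter> space M" "b = Y -` B \<inter> space M"
      by blast
    then have "A \<inter> B \<in> sets borel" by blast
    moreover have "a \<inter> b = Y -` (A \<inter> B) \<inter> space M" using ab by blast
    ultimately show "a \<inter> b \<in> {Y -` A \<inter> space M | A. A \<in> sets borel}" by blast
  qed
  then show "Int_stable ?A" "Int_stable ?B" by blast+
  have "?A \<subseteq> {U -` A \<inter> space M | A. A \<in> sets S}"
  proof safe
    fix A :: "real set" assume "A \<in> sets borel"
    then have "g -` A \<inter> space S \<in> sets S" using g by measurable
    moreover have "(\<lambda>\<omega>. g (U \<omega>)) -` A \<inter> space M = U -` (g -` A \<inter> space S) \<inter> space M"
      using measurable_space[of U M S] assms(2) by auto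
    ultimately show "\<exists>B. (\<lambda>\<omega>. g (U \<omega>)) -` A \<inter> space M = U -` B \<inter> space M \<and> B \<in> sets S"
      by blast
  qed
  moreover have "?B \<subseteq> {V -` B \<inter> space M | B. B \<in> sets T}"
  proof safe
    fix A :: "real set" assume "A \<in> sets borel"
    then have "h -` A \<inter> space T \<in> sets T" using h by measurable
    moreover have "(\<lambda>\<omega>. h (V \<omega>)) -` A \<inter> space M = V -` (h -` A \<inter> space T) \<inter> space M"
      using measurable_space[of V M T] assms(3) by auto
    ultimately show "\<exists>B. (\<lambda>\<omega>. h (V \<omega>)) -` A \<inter> space M = V -` B \<inter> space M \<and> B \<in> sets T"
      by blast
  qed
  ultimately show "indep_set ?A ?B"
    unfolding indep_set_def
    by (intro indep_sets_mono_sets[OF indep[unfolded indep_set_def]]) (auto split: bool.split)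
qed measurable

text \<open>By Tonelli the series has finite mean, so it converges almost surely and its terms
  vanish. This takes the place of Markov's inequality with Borel-Cantelli.\<close>

lemma (in prob_space) AE_tendsto_zero_if_summable_expectation:
  fixes Z :: "nat \<Rightarrow> 'a \<Rightarrow> real"
  assumes int: "\<And>r. integrable M (Z r)"
    and nonneg: "\<And>r \<omega>. 0 \<le> Z r \<omega>"
    and sum: "summable (\<lambda>r. expectation (Z r))"
  shows "AE \<omega> in M. (\<lambda>r. Z r \<omega>) \<longlonglongrightarrow> 0"
proof -
  have [measurable]: "Z r \<in> borel_measurable M" for r
    using int by simp
  have "(\<integral>\<^sup>+\<omega>. (\<Sum>r. ennreal (Z r \<omega>)) \<partial>M) = (\<Sum>r. \<integral>\<^sup>+\<omega>. ennreal (Z r \<omega>) \<partial>M)"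
    by (rule nn_integral_suminf) measurable
  also have "\<dots> = (\<Sum>r. ennreal (expectation (Z r)))"
    using int nonneg by (simp add: nn_integral_eq_integral)
  also have "\<dots> = ennreal (\<Sum>r. expectation (Z r))"
    using sum nonneg by (intro suminf_ennreal2) (auto intro: integral_nonneg)
  finally have "(\<integral>\<^sup>+\<omega>. (\<Sum>r. ennreal (Z r \<omega>)) \<partial>M) \<noteq> \<infinity>"
    by simp
  then have "AE \<omega> in M. (\<Sum>r. ennreal (Z r \<omega>)) \<noteq> \<infinity>"
    by (intro nn_integral_PInf_AE) auto
  then show ?thesis
  proof eventually_elim
    case (elim \<omega>)
    then have "summable (\<lambda>r. Z r \<omega>)"
      using nonneg by (intro summable_suminf_not_top) auto
    then show ?case by (rule summable_LIMSEQ_zero)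
  qed
qed

subsection \<open>Uniform level-preserving permutations\<close>

lemma finite_Tr [simp, intro]: "finite (Tr r)"
  by (simp add: Tr_def)

lemma Gen_subset_Tr: "q \<le> r \<Longrightarrow> Gen q \<subseteq> Tr r"
  by (auto simp: Tr_def)

lemma finite_levperms: "finite (levperms r)"
  by (rule finite_subset[OF _ finite_permutations[of "Tr r"]]) (auto simp: levperms_def)

lemma Gen_disjoint: "i \<in> Gen q \<Longrightarrow> i \<in> Gen r \<Longrightarrow> q = r"
proof -
  have "\<not> q < r" if "i \<in> Gen q" "i \<in> Gen r" for q r
  proof
    assume "q < r"
    then have "(2::nat) ^ Suc q \<le> 2 ^ r" by (intro power_increasing) auto
    with that show False by (auto simp: Gen_def)
  qed
  then show "i \<in> Gen q \<Longrightarrow> i \<in> Gen r \<Longrightarrow> q = r" by (meson linorder_neqE_nat)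
qed

definition levperms_at :: "nat \<Rightarrow> nat \<Rightarrow> nat \<Rightarrow> nat \<Rightarrow> nat \<Rightarrow> (nat \<Rightarrow> nat) set" where
  "levperms_at r i j a b = {\<sigma> \<in> levperms r. \<sigma> i = a \<and> \<sigma> j = b}"

definition off_diagonal :: "nat set \<Rightarrow> (nat \<times> nat) set" where
  "off_diagonal A = {(a, b) \<in> A \<times> A. a \<noteq> b}"

lemma finite_off_diagonal [simp, intro]: "finite A \<Longrightarrow> finite (off_diagonal A)"
  by (rule finite_subset[of _ "A \<times> A"]) (auto simp: off_diagonal_def)

lemma sum_off_diagonal:
  fixes h :: "nat \<Rightarrow> nat \<Rightarrow> 'a::ab_group_add"
  assumes "finite A"
  shows "(\<Sum>(a, b)\<in>off_diagonal A. h a b) = (\<Sum>a\<in>A. \<Sum>b\<in>A. h a b) - (\<Sum>a\<in>A. h a a)"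
proof -
  have eq: "A \<times> A = off_diagonal A \<union> (\<lambda>a. (a, a)) ` A"
    by (auto simp: off_diagonal_def)
  have "(\<Sum>(a, b)\<in>A \<times> A. h a b)
      = (\<Sum>(a, b)\<in>off_diagonal A. h a b) + (\<Sum>(a, b)\<in>(\<lambda>a. (a, a)) ` A. h a b)"
    unfolding eq using assms
    by (intro sum.union_disjoint finite_off_diagonal finite_imageI) (auto simp: off_diagonal_def)
  then show ?thesis
    by (simp add: sum.cartesian_product sum.reindex inj_on_def)
qed

lemma sum_square_off_diagonal:
  fixes h :: "nat \<Rightarrow> real"
  assumes "finite A"
  shows "(\<Sum>a\<in>A. h a)\<^sup>2 = (\<Sum>a\<in>A. (h a)\<^sup>2) + (\<Sum>(a, b)\<in>off_diagonal A. h a * h b)"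
  unfolding sum_off_diagonal[OF assms] by (simp add: power2_eq_square sum_product)

text \<open>Permutations of a single generation act on \<open>levperms r\<close> from the left; the
  other generations are left fixed because generations are disjoint.\<close>

lemma levperms_comp:
  assumes "\<sigma> \<in> levperms r" "\<tau> permutes Gen q" "q \<le> r"
  shows "\<tau> \<circ> \<sigma> \<in> levperms r"
proof -
  have "\<tau> permutes Tr r"
    using assms Gen_subset_Tr by (metis permutes_subset)
  moreover have "\<tau> ` Gen p = Gen p" for p
  proof (cases "p = q")
    case False
    then have "\<tau> i = i" if "i \<in> Gen p" for i
      using that assms(2) Gen_disjoint by (metis permutes_not_in)
    then show ?thesis by force
  qed (use assms in \<open>auto simp: permutes_image\<close>)
  ultimately show ?thesis
    using assms(1) by (auto simp: levperms_def permutes_compose simp flip: image_image)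
qed

text \<open>Symmetry: left composition with a permutation taking \<open>(a, b)\<close> to
  \<open>(a', b')\<close> is injective and maps one fibre into the other. Exchanging the two pairs
  gives equality.\<close>

lemma card_levperms_at_le:
  assumes "(a, b) \<in> off_diagonal (Gen r)" "(a', b') \<in> off_diagonal (Gen r)"
  shows "card (levperms_at r i j a b) \<le> card (levperms_at r i j a' b')"
proof -
  \<comment> \<open>The first swap takes \<open>a\<close> to \<open>a'\<close> and \<open>b\<close>
    to \<open>c\<close>; the second takes \<open>c\<close> to \<open>b'\<close> and spares
    \<open>a'\<close>, from which both \<open>c\<close> and \<open>b'\<close> differ.\<close>
  define c where "c = Transposition.transpose a a' b"
  define \<tau> where "\<tau> = Transposition.transpose c b' \<circ> Transposition.transpose a a'"
  have c: "c \<in> Gen r" "c \<noteq> a'"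
    using assms by (auto simp: c_def off_diagonal_def Transposition.transpose_def)
  have \<tau>: "\<tau> permutes Gen r"
    unfolding \<tau>_def using assms c
    by (intro permutes_compose permutes_swap_id) (auto simp: off_diagonal_def)
  have "\<tau> a = a'" "\<tau> b = b'"
    using assms c by (auto simp: \<tau>_def c_def off_diagonal_def Transposition.transpose_def)
  then have "(\<circ>) \<tau> ` levperms_at r i j a b \<subseteq> levperms_at r i j a' b'"
    using levperms_comp[OF _ \<tau> order_refl] by (auto simp: levperms_at_def)
  moreover have "inj_on ((\<circ>) \<tau>) (levperms_at r i j a b)"
    using permutes_inj[OF \<tau>] by (auto intro!: inj_onI simp: fun.inj_map_strong fun_eq_iff inj_eq)
  moreover have "finite (levperms_at r i j a' b')"
    using finite_levperms by (simp add: levperms_at_def)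
  ultimately show ?thesis by (meson card_inj_on_le)
qed

lemma levperms_Gen: "\<sigma> \<in> levperms r \<Longrightarrow> i \<in> Gen r \<Longrightarrow> \<sigma> i \<in> Gen r"
  by (auto simp: levperms_def)

lemma id_in_levperms: "id \<in> levperms r"
  by (simp add: levperms_def permutes_id)

text \<open>Distinct \<open>i\<close> and \<open>j\<close> have distinct images, so the fibres over
  off-diagonal pairs partition \<open>levperms r\<close>, and by symmetry they have equal
  size.\<close>

lemma card_levperms_at:
  assumes ij: "(i, j) \<in> off_diagonal (Gen r)" and ab: "(a, b) \<in> off_diagonal (Gen r)"
  shows "card (levperms_at r i j a b) * card (off_diagonal (Gen r)) = card (levperms r)"
proof -
  have "levperms r = (\<Union>(c, d)\<in>off_diagonal (Gen r). levperms_at r i j c d)"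
  proof -
    have "(\<sigma> i, \<sigma> j) \<in> off_diagonal (Gen r)" if "\<sigma> \<in> levperms r" for \<sigma>
    proof -
      have "inj \<sigma>" using that by (auto simp: levperms_def permutes_inj)
      then show ?thesis
        using ij that levperms_Gen by (auto simp: off_diagonal_def inj_eq)
    qed
    then show ?thesis by (fastforce simp: levperms_at_def)
  qed
  also have "card \<dots> = (\<Sum>(c, d)\<in>off_diagonal (Gen r). card (levperms_at r i j c d))"
    using finite_levperms[of r]
    by (subst card_UN_disjoint) (auto simp: levperms_at_def split_def intro!: sum.cong)
  also have "\<dots> = (\<Sum>(c, d)\<in>off_diagonal (Gen r). card (levperms_at r i j a b))"
    by (intro sum.cong) (auto intro!: antisym card_levperms_at_le ab)
  finally show ?thesis by (simp add: split_def mult.commute)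
qed

text \<open>The event is a disjoint union of the atoms whose probability
  \<open>is_unif_level_perm\<close> prescribes; their number comes from
  \<open>card_levperms_at\<close>.\<close>

lemma (in prob_space) unif_level_perm_pair:
  assumes \<pi>: "is_unif_level_perm M \<pi>"
    and ij: "(i, j) \<in> off_diagonal (Gen r)" and ab: "(a, b) \<in> off_diagonal (Gen r)"
  shows "prob {\<omega> \<in> space M. \<pi> \<omega> i = a \<and> \<pi> \<omega> j = b} = 1 / card (off_diagonal (Gen r))"
proof -
  have [measurable]: "(\<lambda>\<omega>. \<pi> \<omega> k) \<in> M \<rightarrow>\<^sub>M count_space UNIV" for k
    using \<pi> by (simp add: is_unif_level_perm_def)
  define E where "E \<sigma> = {\<omega> \<in> space M. \<forall>k\<in>Tr r. \<pi> \<omega> k = \<sigma> k}" for \<sigma>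
  have [measurable]: "E \<sigma> \<in> sets M" for \<sigma>
    unfolding E_def by measurable
  have iT: "i \<in> Tr r" "j \<in> Tr r"
    using ij Gen_subset_Tr[of r r] by (auto simp: off_diagonal_def)
  have "{\<omega> \<in> space M. \<pi> \<omega> i = a \<and> \<pi> \<omega> j = b} = (\<Union>\<sigma>\<in>levperms_at r i j a b. E \<sigma>)"
  proof (intro equalityI subsetI)
    fix \<omega> assume \<omega>: "\<omega> \<in> {\<omega> \<in> space M. \<pi> \<omega> i = a \<and> \<pi> \<omega> j = b}"
    \<comment> \<open>Members of \<open>levperms r\<close> fix everything outside
      \<open>Tr r\<close>, so the infinite permutation is cut off to the identity there.\<close>
    define \<sigma> where "\<sigma> k = (if k \<in> Tr r then \<pi> \<omega> k else k)" for k
    have "\<pi> \<omega> permutes {0<..}" and img: "\<And>q. \<pi> \<omega> ` Gen q = Gen q"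
      using \<pi> \<omega> by (auto simp: is_unif_level_perm_def)
    then have "inj (\<pi> \<omega>)" by (simp add: permutes_inj)
    moreover have "\<pi> \<omega> ` Tr r = Tr r"
      unfolding Tr_def image_UN using img by simp
    ultimately have "bij_betw (\<pi> \<omega>) (Tr r) (Tr r)"
      by (auto simp: bij_betw_def intro: inj_on_subset)
    then have "bij_betw \<sigma> (Tr r) (Tr r)"
      by (subst bij_betw_cong[of _ _ "\<pi> \<omega>"]) (auto simp: \<sigma>_def)
    then have "\<sigma> permutes Tr r"
      by (rule bij_imp_permutes) (simp add: \<sigma>_def)
    moreover have "\<sigma> ` Gen q = Gen q" if "q \<le> r" for q
    proof -
      have "\<sigma> ` Gen q = \<pi> \<omega> ` Gen q"
        using Gen_subset_Tr[OF that] by (intro image_cong) (auto simp: \<sigma>_def)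
      then show ?thesis using img by simp
    qed
    ultimately have "\<sigma> \<in> levperms_at r i j a b"
      using \<omega> iT by (auto simp: levperms_at_def levperms_def \<sigma>_def)
    moreover have "\<omega> \<in> E \<sigma>"
      using \<omega> by (auto simp: E_def \<sigma>_def)
    ultimately show "\<omega> \<in> (\<Union>\<sigma>\<in>levperms_at r i j a b. E \<sigma>)" by blast
  qed (use iT in \<open>auto simp: E_def levperms_at_def\<close>)
  moreover have "disjoint_family_on E (levperms_at r i j a b)"
  proof (unfold disjoint_family_on_def, intro ballI impI)
    fix \<sigma> \<tau> assume st: "\<sigma> \<in> levperms_at r i j a b" "\<tau> \<in> levperms_at r i j a b" "\<sigma> \<noteq> \<tau>"
    then obtain k where k: "\<sigma> k \<noteq> \<tau> k" by blast
    \<comment> \<open>Both are the identity outside \<open>Tr r\<close>, so they differ at a point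
      that \<open>E\<close> observes.\<close>
    then have "k \<in> Tr r"
      using st by (auto simp: levperms_at_def levperms_def permutes_not_in)
    with k show "E \<sigma> \<inter> E \<tau> = {}" by (auto simp: E_def)
  qed
  moreover have "finite (levperms_at r i j a b)"
    using finite_levperms by (simp add: levperms_at_def)
  ultimately have "prob {\<omega> \<in> space M. \<pi> \<omega> i = a \<and> \<pi> \<omega> j = b}
      = (\<Sum>\<sigma>\<in>levperms_at r i j a b. prob (E \<sigma>))"
    by (simp add: finite_measure_finite_Union image_subset_iff)
  also have "\<dots> = (\<Sum>\<sigma>\<in>levperms_at r i j a b. 1 / real (card (levperms r)))"
    using \<pi> by (intro sum.cong) (auto simp: is_unif_level_perm_def levperms_at_def E_def)
  also have "\<dots> = card (levperms_at r i j a b) / real (card (levperms r))"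
    by simp
  also have "\<dots> = 1 / card (off_diagonal (Gen r))"
  proof -
    have "card (levperms r) \<noteq> 0"
      using finite_levperms id_in_levperms by (auto simp: card_eq_0_iff)
    then show ?thesis
      unfolding card_levperms_at[OF ij ab, symmetric] by (simp add: field_simps)
  qed
  finally show ?thesis .
qed

subsection \<open>The mean transition kernel\<close>

lemma average_ennreal: "a * inverse 2 + b * inverse 2 = (b + a) / (2 :: ennreal)"
  by (simp only: divide_ennreal_def distrib_right add.commute)

lemma distr_projection_subprob:
  fixes N :: "('s::metric_space \<times> 's) measure"
  assumes "prob_space N" "sets N = sets (borel \<Otimes>\<^sub>M borel)"
  shows "(\<lambda>b. distr N borel (if b then fst else snd)) \<in> measure_pmf p \<rightarrow>\<^sub>M subprob_algebra borel"
proof -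
  have [measurable]: "fst \<in> N \<rightarrow>\<^sub>M borel" "snd \<in> N \<rightarrow>\<^sub>M borel"
    by (simp_all add: measurable_cong_sets[OF assms(2) refl])
  show ?thesis
    by (auto simp: space_subprob_algebra
        intro!: prob_space_imp_subprob_space prob_space.prob_space_distr assms(1))
qed

text \<open>A set function passed to \<open>measure_of\<close> is respected only if it is a measure;
  otherwise the result is zero. Writing the kernel as the law of a daughter picked by a fair coin
  supplies countable additivity and gives access to the integration rules for
  \<open>bind\<close>.\<close>

lemma Qker_eq_bind:
  fixes P :: "'s::metric_space \<Rightarrow> ('s \<times> 's) measure"
  assumes P: "prob_space (P x)" "sets (P x) = sets (borel \<Otimes>\<^sub>M borel)"
  shows "Qker P x
    = measure_pmf (bernoulli_pmf (1/2)) \<bind> (\<lambda>b. distr (P x) borel (if b then fst else snd))"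
    (is "_ = ?K")
proof -
  have [measurable]: "fst \<in> P x \<rightarrow>\<^sub>M borel" "snd \<in> P x \<rightarrow>\<^sub>M borel"
    by (simp_all add: measurable_cong_sets[OF P(2) refl])
  have sp: "space (P x) = UNIV"
    using sets_eq_imp_space_eq[OF P(2)] by (simp add: space_pair_measure)
  note K = distr_projection_subprob[OF P]
  have sets: "sets ?K = sets borel"
    by (rule sets_bind_measurable[OF K]) simp
  have em: "emeasure ?K B = (emeasure (P x) (B \<times> UNIV) + emeasure (P x) (UNIV \<times> B)) / 2"
    if "B \<in> sets borel" for B
  proof -
    have "(fst :: 's \<times> 's \<Rightarrow> 's) -` B = B \<times> UNIV" "(snd :: 's \<times> 's \<Rightarrow> 's) -` B = UNIV \<times> B"
      by auto
    then show ?thesis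
      using that
      by (simp add: emeasure_bind[OF _ K] emeasure_distr sp nn_integral_measure_pmf_finite UNIV_bool
          average_ennreal)
  qed
  have "Qker P x = measure_of (space borel) (sets borel) (emeasure ?K)"
    unfolding Qker_def using em sets.sigma_sets_eq[of "borel :: 's measure"]
    by (intro measure_of_eq) (auto simp del: sets.sigma_sets_eq)
  also have "\<dots> = measure_of (space ?K) (sets ?K) (emeasure ?K)"
    using sets_eq_imp_space_eq[OF sets] by (simp add: sets)
  finally show ?thesis unfolding measure_of_of_measure .
qed

section \<open>The setting, and the operator Q on the space F\<close>

locale bifurcating_chain = prob_space M
  for M :: "'w measure" +
  fixes X :: "nat \<Rightarrow> 'w \<Rightarrow> 's::metric_space"
    and \<nu> :: "'s measure"
    and P :: "'s \<Rightarrow> ('s \<times> 's) measure"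
    and F :: "('s \<Rightarrow> real) set"
  assumes P_kernel: "P \<in> borel \<rightarrow>\<^sub>M prob_algebra (borel \<Otimes>\<^sub>M borel)"
    and BMC: "is_BMC M X \<nu> P"
    and F_meas: "F \<subseteq> borel_measurable borel"
    and F_add: "\<And>g h. g \<in> F \<Longrightarrow> h \<in> F \<Longrightarrow> (\<lambda>x. g x + h x) \<in> F"
    and F_smult: "\<And>c g. g \<in> F \<Longrightarrow> (\<lambda>x. c * g x) \<in> F"
    and F_const: "\<And>c. (\<lambda>_. c) \<in> F"
    and F_square: "\<And>g. g \<in> F \<Longrightarrow> (\<lambda>x. (g x)\<^sup>2) \<in> F"
    and F_tensor: "\<And>x g h. g \<in> F \<Longrightarrow> h \<in> F \<Longrightarrow>
                  integrable (P x) (\<lambda>yz. g (fst yz) * h (snd yz)) \<and>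
                  (\<lambda>x'. \<integral>yz. g (fst yz) * h (snd yz) \<partial>(P x')) \<in> F"
    and F_initial: "\<And>g. g \<in> F \<Longrightarrow> integrable \<nu> g"
begin

lemma F_measurable [measurable_dest]: "u \<in> F \<Longrightarrow> u \<in> borel_measurable borel"
  using F_meas by auto

lemma X_measurable [measurable]: "X n \<in> M \<rightarrow>\<^sub>M borel"
  using BMC by (simp add: is_BMC_def)

lemma law_root: "distr M borel (X 1) = \<nu>"
  using BMC by (simp add: is_BMC_def)

lemma P_subprob [measurable]: "P \<in> borel \<rightarrow>\<^sub>M subprob_algebra (borel \<Otimes>\<^sub>M borel)"
  using P_kernel by (rule measurable_prob_algebraD)

lemma prob_P: "prob_space (P x)" and sets_P [measurable_cong]: "sets (P x) = sets (borel \<Otimes>\<^sub>M borel)"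
  using measurable_space[OF P_kernel, of x] by (auto simp: space_prob_algebra)

lemma space_P [simp]: "space (P x) = UNIV"
  using sets_eq_imp_space_eq[OF sets_P, of x] by (simp add: space_pair_measure)

lemma measure_P_UNIV [simp]: "measure (P x) UNIV = 1"
  using prob_space.prob_space[OF prob_P, of x] by simp

lemma F_diff: "u \<in> F \<Longrightarrow> w \<in> F \<Longrightarrow> (\<lambda>x. u x - w x) \<in> F"
  using F_add[of u "\<lambda>x. (-1) * w x"] F_smult[of w "-1"] by simp

text \<open>\<^term>\<open>F\<close> need not be closed under absolute values, but
  \<open>4 u = (u + 1)\<^sup>2 - (u - 1)\<^sup>2\<close> serves as a Jordan decomposition inside \<^term>\<open>F\<close>.\<close>

lemma F_cases:
  assumes "u \<in> F"
  obtains p q where "p \<in> F" "q \<in> F" "\<And>x. 0 \<le> p x" "\<And>x. 0 \<le> q x" "u = (\<lambda>x. p x - q x)"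
proof
  show "(\<lambda>x. 1/4 * (u x + 1)\<^sup>2) \<in> F" "(\<lambda>x. 1/4 * (u x - 1)\<^sup>2) \<in> F"
    by (intro F_smult F_square F_add F_diff F_const assms)+
  show "u = (\<lambda>x. 1/4 * (u x + 1)\<^sup>2 - 1/4 * (u x - 1)\<^sup>2)"
    by (simp add: fun_eq_iff power2_eq_square field_simps)
qed simp_all

text \<open>The majorant is \<open>u^2 + 1\<close>, from \<open>2 |u| <= u^2 + 1\<close>. It stands
  in for the absolute value as a dominating function inside \<open>F\<close>.\<close>

lemma F_dominated:
  assumes "u \<in> F"
  obtains w where "w \<in> F" "\<And>x. \<bar>u x\<bar> \<le> w x"
proof
  show "(\<lambda>x. (u x)\<^sup>2 + 1) \<in> F"
    by (intro F_square F_add F_const assms)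
  fix x
  have "0 \<le> (\<bar>u x\<bar> - 1)\<^sup>2" by simp
  then have "2 * \<bar>u x\<bar> \<le> (u x)\<^sup>2 + 1" by (simp add: power2_eq_square algebra_simps)
  then show "\<bar>u x\<bar> \<le> (u x)\<^sup>2 + 1" by linarith
qed

text \<open>Q acting on functions, written with both daughters under one integral, which is how the
  chain supplies it. \<open>Qpow_eq\<close> identifies its iterates with those of the
  kernel.\<close>

definition Qop :: "('s \<Rightarrow> real) \<Rightarrow> 's \<Rightarrow> real" where
  "Qop u x = (\<integral>yz. u (fst yz) + u (snd yz) \<partial>P x) / 2"

text \<open>Condition (iii) with one factor equal to the constant \<open>1\<close>.\<close>

lemma
  assumes "u \<in> F"
  shows integrable_P_fst: "integrable (P x) (\<lambda>yz. u (fst yz))"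
    and integrable_P_snd: "integrable (P x) (\<lambda>yz. u (snd yz))"
  using F_tensor[OF assms F_const[of 1], of x] F_tensor[OF F_const[of 1] assms, of x] by simp_all

lemma Qop_alt: "u \<in> F \<Longrightarrow> Qop u x = ((\<integral>yz. u (fst yz) \<partial>P x) + (\<integral>yz. u (snd yz) \<partial>P x)) / 2"
  by (simp add: Qop_def integrable_P_fst integrable_P_snd)

lemma Qop_F: "u \<in> F \<Longrightarrow> Qop u \<in> F"
proof -
  assume u: "u \<in> F"
  have "(\<lambda>x. 1/2 * ((\<integral>yz. u (fst yz) * 1 \<partial>P x) + (\<integral>yz. 1 * u (snd yz) \<partial>P x))) \<in> F"
    using u F_const by (intro F_smult F_add conjunct2[OF F_tensor])
  also have "(\<lambda>x. 1/2 * ((\<integral>yz. u (fst yz) * 1 \<partial>P x) + (\<integral>yz. 1 * u (snd yz) \<partial>P x))) = Qop u"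
    using u by (simp add: Qop_alt fun_eq_iff)
  finally show ?thesis .
qed

lemma Qop_funpow_F: "u \<in> F \<Longrightarrow> (Qop ^^ r) u \<in> F"
  by (induction r) (auto intro: Qop_F)

lemma Qop_nonneg: "(\<And>x. 0 \<le> u x) \<Longrightarrow> 0 \<le> Qop u x"
  by (simp add: Qop_def integral_nonneg)

lemma Qop_diff: "u \<in> F \<Longrightarrow> w \<in> F \<Longrightarrow> Qop (\<lambda>x. u x - w x) x = Qop u x - Qop w x"
  by (simp add: Qop_alt F_diff integrable_P_fst integrable_P_snd diff_divide_distrib add_divide_distrib)

lemma nn_integral_P:
  assumes "u \<in> F" "\<And>x. 0 \<le> u x"
  shows "(\<integral>\<^sup>+yz. ennreal (u (fst yz) + u (snd yz)) \<partial>P x) = ennreal (2 * Qop u x)"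
proof -
  have "2 * Qop u x = (\<integral>yz. u (fst yz) + u (snd yz) \<partial>P x)"
    unfolding Qop_def by simp
  with assms show ?thesis
    by (simp only:) (intro nn_integral_eq_integral, auto simp: integrable_P_fst integrable_P_snd)
qed

lemma nn_integral_Qker:
  assumes [measurable]: "u \<in> borel_measurable borel"
  shows "(\<integral>\<^sup>+y. u y \<partial>Qker P x) = ((\<integral>\<^sup>+yz. u (fst yz) \<partial>P x) + (\<integral>\<^sup>+yz. u (snd yz) \<partial>P x)) / 2"
proof -
  have [measurable]: "fst \<in> P x \<rightarrow>\<^sub>M borel" "snd \<in> P x \<rightarrow>\<^sub>M borel"
    by simp_all
  note K = distr_projection_subprob[OF prob_P sets_P]
  show ?thesis
    unfolding Qker_eq_bind[OF prob_P sets_P] nn_integral_bind[OF assms K]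
    by (simp add: nn_integral_distr nn_integral_measure_pmf_finite UNIV_bool
        average_ennreal)
qed

lemma Qker_subprob [measurable]: "Qker P \<in> borel \<rightarrow>\<^sub>M subprob_algebra borel"
proof (rule measurable_subprob_algebra)
  fix x
  note K = distr_projection_subprob[OF prob_P sets_P]
  show sets: "sets (Qker P x) = sets borel"
    unfolding Qker_eq_bind[OF prob_P sets_P] by (rule sets_bind_measurable[OF K]) simp
  show "subprob_space (Qker P x)"
    unfolding Qker_eq_bind[OF prob_P sets_P]
    by (rule subprob_space_bind[OF _ K]) (simp add: prob_space_imp_subprob_space prob_space_measure_pmf)
next
  fix A :: "'s set" assume [measurable]: "A \<in> sets borel"
  have "sets (Qker P x) = sets borel" for x
    using sets.sigma_sets_eq[of borel] by (simp add: Qker_def)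
  then have "emeasure (Qker P x) A
      = ((\<integral>\<^sup>+yz. indicator A (fst yz) \<partial>P x) + (\<integral>\<^sup>+yz. indicator A (snd yz) \<partial>P x)) / 2" for x
    by (simp flip: nn_integral_Qker)
  then show "(\<lambda>x. emeasure (Qker P x) A) \<in> borel_measurable borel"
    by simp
qed

lemma Qn_sets [measurable_cong]: "sets (Qn P r x) = sets borel"
proof (induction r)
  case (Suc r)
  have "Qker P \<in> Qn P r x \<rightarrow>\<^sub>M subprob_algebra borel"
    using Qker_subprob by (simp add: measurable_cong_sets[OF Suc refl])
  moreover have "space (Qn P r x) \<noteq> {}"
    using sets_eq_imp_space_eq[OF Suc] by simp
  ultimately show ?case by (simp add: sets_bind_measurable)
qed simp

lemma nn_integral_Qker_F:
  assumes "u \<in> F" "\<And>x. 0 \<le> u x"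
  shows "(\<integral>\<^sup>+y. ennreal (u y) \<partial>Qker P x) = ennreal (Qop u x)"
proof -
  have [measurable]: "u \<in> borel_measurable borel" using assms by auto
  have "(\<integral>\<^sup>+y. ennreal (u y) \<partial>Qker P x) = (\<integral>\<^sup>+yz. ennreal (u (fst yz) + u (snd yz)) \<partial>P x) / 2"
    using assms by (subst nn_integral_Qker) (simp_all add: nn_integral_add)
  also have "\<dots> = ennreal (Qop u x)"
    unfolding nn_integral_P[OF assms]
    using divide_ennreal[of "2 * Qop u x" 2] Qop_nonneg[of u x] assms by simp
  finally show ?thesis .
qed

text \<open>\<open>Qn\<close> appends its last step, so integrating \<open>u\<close> peels off
  \<open>Qop u\<close> and the induction continues with that function; hence \<open>u\<close> is
  arbitrary. Integrability and value come together from the nonnegative integral.\<close>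

lemma Qn_integral:
  assumes "u \<in> F"
  shows "integrable (Qn P r x) u \<and> (\<integral>y. u y \<partial>Qn P r x) = (Qop ^^ r) u x"
  using assms
proof (induction r arbitrary: u)
  case 0
  then show ?case
    by (auto simp: integrable_iff_bounded nn_integral_return integral_return)
next
  case (Suc r)
  have K: "Qker P \<in> Qn P r x \<rightarrow>\<^sub>M subprob_algebra borel"
    using Qker_subprob by (simp add: measurable_cong_sets[OF Qn_sets refl])
  have nonneg: "integrable (Qn P (Suc r) x) p \<and> (\<integral>y. p y \<partial>Qn P (Suc r) x) = (Qop ^^ r) (Qop p) x"
    if p: "p \<in> F" "\<And>x. 0 \<le> p x" for p
  proof -
    have [measurable]: "p \<in> borel_measurable borel" using p by auto
    note IH = Suc.IH[OF Qop_F[OF p(1)]]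
    have "(\<integral>\<^sup>+y. ennreal (p y) \<partial>Qn P (Suc r) x) = (\<integral>\<^sup>+y. ennreal (Qop p y) \<partial>Qn P r x)"
      unfolding Qn.simps by (subst nn_integral_bind[OF _ K]) (simp_all add: nn_integral_Qker_F p)
    also have "\<dots> = ennreal ((Qop ^^ r) (Qop p) x)"
      using IH Qop_nonneg[OF p(2)] by (simp add: nn_integral_eq_integral)
    finally have eq: "(\<integral>\<^sup>+y. ennreal (p y) \<partial>Qn P (Suc r) x) = ennreal ((Qop ^^ r) (Qop p) x)" .
    have meas: "p \<in> borel_measurable (Qn P (Suc r) x)"
      unfolding measurable_cong_sets[OF Qn_sets refl] by measurable
    have nn: "0 \<le> (Qop ^^ r) (Qop p) x"
      unfolding conjunct2[OF IH, symmetric] by (intro integral_nonneg_AE AE_I2 Qop_nonneg p)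
    have int: "integrable (Qn P (Suc r) x) p"
      by (rule integrableI_nn_integral_finite[OF meas _ eq]) (simp add: p)
    have "ennreal (\<integral>y. p y \<partial>Qn P (Suc r) x) = ennreal ((Qop ^^ r) (Qop p) x)"
      unfolding eq[symmetric] by (intro nn_integral_eq_integral[symmetric] int) (simp add: p)
    moreover have "0 \<le> (\<integral>y. p y \<partial>Qn P (Suc r) x)"
      by (intro integral_nonneg_AE AE_I2 p)
    ultimately show ?thesis
      using int nn by (simp del: Qn.simps)
  qed
  obtain p q where pq: "p \<in> F" "q \<in> F" "\<And>x. 0 \<le> p x" "\<And>x. 0 \<le> q x" "u = (\<lambda>x. p x - q x)"
    using F_cases[OF Suc.prems] by metis
  have "Qop u = (\<lambda>x. Qop p x - Qop q x)"
    unfolding pq(5) by (intro ext Qop_diff pq)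
  \<comment> \<open>Linearity of the iterate is read off from that of the integral against
    \<open>Qn P r x\<close>, by the induction hypothesis for all three functions.\<close>
  then have "(Qop ^^ r) (Qop u) x = (Qop ^^ r) (Qop p) x - (Qop ^^ r) (Qop q) x"
    using Suc.IH[OF Qop_F[OF pq(1)]] Suc.IH[OF Qop_F[OF pq(2)]] Suc.IH[OF Qop_F[OF Suc.prems]] by simp
  moreover have "integrable (Qn P (Suc r) x) u
      \<and> (\<integral>y. u y \<partial>Qn P (Suc r) x) = (Qop ^^ r) (Qop p) x - (Qop ^^ r) (Qop q) x"
    using nonneg[OF pq(1,3)] nonneg[OF pq(2,4)] unfolding pq(5) by (simp del: Qn.simps)
  ultimately show ?case
    by (simp add: funpow_swap1 del: Qn.simps)
qed

lemma Qpow_eq: "u \<in> F \<Longrightarrow> Qpow P r u x = (Qop ^^ r) u x"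
  using Qn_integral by (simp add: Qpow_def)

subsection \<open>One step of the bifurcating chain\<close>

text \<open>The defining conditional identity, averaged by the tower property, for functions that
  ignore the mother's own value.\<close>

lemma expectation_prod_Gen:
  fixes h :: "nat \<Rightarrow> 's \<times> 's \<Rightarrow> real"
  assumes [measurable]: "\<And>n. h n \<in> borel_measurable (borel \<Otimes>\<^sub>M borel)"
    and bounded: "\<And>n t. \<bar>h n t\<bar> \<le> B"
  shows "expectation (\<lambda>\<omega>. \<Prod>n\<in>Gen r. h n (X (2*n) \<omega>, X (2*n+1) \<omega>))
       = expectation (\<lambda>\<omega>. \<Prod>n\<in>Gen r. \<integral>yz. h n yz \<partial>P (X n \<omega>))"
proof -
  define G where "G = Filt M X r"
  have "subalgebra M G"
  proof -
    have "space G = space M"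
      unfolding G_def Filt_def by (intro space_measure_of) auto
    moreover have "sets G \<subseteq> sets M"
      unfolding G_def Filt_def by (subst sets_measure_of) (auto intro!: sets.sigma_sets_subset)
    ultimately show ?thesis by (simp add: subalgebra_def)
  qed
  then interpret finite_measure_subalgebra M G
    by unfold_locales
  define fs :: "nat \<Rightarrow> 's \<times> 's \<times> 's \<Rightarrow> real" where "fs n t = h n (snd t)" for n t
  have [measurable]: "fs n \<in> borel_measurable (borel \<Otimes>\<^sub>M borel \<Otimes>\<^sub>M borel)" for n
    unfolding fs_def by measurable
  have "\<forall>n\<in>Gen r. fs n \<in> borel_measurable (borel \<Otimes>\<^sub>M borel \<Otimes>\<^sub>M borel) \<and> (\<exists>B. \<forall>t. \<bar>fs n t\<bar> \<le> B)"
    using bounded by (auto simp: fs_def)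
  then have "AE \<omega> in M. real_cond_exp M G (\<lambda>\<omega>. \<Prod>n\<in>Gen r. fs n (X n \<omega>, X (2*n) \<omega>, X (2*n+1) \<omega>)) \<omega>
      = (\<Prod>n\<in>Gen r. \<integral>yz. fs n (X n \<omega>, fst yz, snd yz) \<partial>P (X n \<omega>))"
    using BMC unfolding is_BMC_def G_def by blast
  then have ae: "AE \<omega> in M. real_cond_exp M G (\<lambda>\<omega>. \<Prod>n\<in>Gen r. h n (X (2*n) \<omega>, X (2*n+1) \<omega>)) \<omega>
      = (\<Prod>n\<in>Gen r. \<integral>yz. h n yz \<partial>P (X n \<omega>))"
    by (simp add: fs_def)
  have "integrable M (\<lambda>\<omega>. \<Prod>n\<in>Gen r. h n (X (2*n) \<omega>, X (2*n+1) \<omega>))"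
  proof (rule integrable_const_bound[where B = "\<Prod>n\<in>Gen r. B"])
    show "AE \<omega> in M. norm (\<Prod>n\<in>Gen r. h n (X (2*n) \<omega>, X (2*n+1) \<omega>)) \<le> (\<Prod>n\<in>Gen r. B)"
      unfolding real_norm_def abs_prod using bounded by (intro AE_I2 prod_mono) auto
  qed measurable
  then have "expectation (\<lambda>\<omega>. \<Prod>n\<in>Gen r. h n (X (2*n) \<omega>, X (2*n+1) \<omega>))
      = expectation (real_cond_exp M G (\<lambda>\<omega>. \<Prod>n\<in>Gen r. h n (X (2*n) \<omega>, X (2*n+1) \<omega>)))"
    by (simp add: real_cond_exp_int)
  also have "\<dots> = expectation (\<lambda>\<omega>. \<Prod>n\<in>Gen r. \<integral>yz. h n yz \<partial>P (X n \<omega>))"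
  proof (rule integral_cong_AE[OF _ _ ae])
    show "(\<lambda>\<omega>. \<Prod>n\<in>Gen r. \<integral>yz. h n yz \<partial>P (X n \<omega>)) \<in> borel_measurable M"
    proof (intro borel_measurable_prod)
      fix n
      have "(\<lambda>x. \<integral>yz. h n yz \<partial>P x) \<in> borel_measurable borel"
        using integral_measurable_subprob_algebra P_subprob assms by measurable
      then show "(\<lambda>\<omega>. \<integral>yz. h n yz \<partial>P (X n \<omega>)) \<in> borel_measurable M"
        by measurable
    qed
  qed simp
  finally show ?thesis .
qed

text \<open>All factors but one are the constant \<open>1\<close>, which integrates to
  \<open>1\<close> under every \<open>P x\<close>.\<close>

lemma expectation_daughters:
  assumes "n \<in> Gen r" and [measurable]: "h \<in> borel_measurable (borel \<Otimes>\<^sub>M borel)"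
    and "\<And>t. \<bar>h t :: real\<bar> \<le> B"
  shows "expectation (\<lambda>\<omega>. h (X (2*n) \<omega>, X (2*n+1) \<omega>)) = expectation (\<lambda>\<omega>. \<integral>yz. h yz \<partial>P (X n \<omega>))"
proof -
  have *: "(\<Prod>k\<in>Gen r. if k = n then g k else 1) = g n" for g :: "nat \<Rightarrow> real"
    using assms(1) by (simp add: prod.delta)
  have "expectation (\<lambda>\<omega>. \<Prod>k\<in>Gen r. (if k = n then h else (\<lambda>_. 1)) (X (2*k) \<omega>, X (2*k+1) \<omega>))
       = expectation (\<lambda>\<omega>. \<Prod>k\<in>Gen r. \<integral>yz. (if k = n then h else (\<lambda>_. 1)) yz \<partial>P (X k \<omega>))"
    \<comment> \<open>The common bound must also cover the constant factors.\<close>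
    using assms(3) by (intro expectation_prod_Gen[where B="max B 1"]) (auto simp: le_max_iff_disj)
  also have "(\<lambda>\<omega>. \<Prod>k\<in>Gen r. (if k = n then h else (\<lambda>_. 1)) (X (2*k) \<omega>, X (2*k+1) \<omega>))
      = (\<lambda>\<omega>. \<Prod>k\<in>Gen r. if k = n then h (X (2*k) \<omega>, X (2*k+1) \<omega>) else 1)"
    by (intro ext prod.cong) auto
  also have "(\<lambda>\<omega>. \<Prod>k\<in>Gen r. \<integral>yz. (if k = n then h else (\<lambda>_. 1)) yz \<partial>P (X k \<omega>))
      = (\<lambda>\<omega>. \<Prod>k\<in>Gen r. if k = n then \<integral>yz. h yz \<partial>P (X k \<omega>) else 1)"
    by (intro ext prod.cong) auto
  finally show ?thesis
    unfolding * by simp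
qed

text \<open>Conditional independence of the offspring of two mothers in the same generation; this
  decouples the off-diagonal terms of a squared sum.\<close>

lemma expectation_two_families:
  assumes nm: "n \<in> Gen r" "m \<in> Gen r" "n \<noteq> m"
    and [measurable]: "h \<in> borel_measurable (borel \<Otimes>\<^sub>M borel)"
    and bounded: "\<And>t. \<bar>h t :: real\<bar> \<le> B"
  shows "expectation (\<lambda>\<omega>. h (X (2*n) \<omega>, X (2*n+1) \<omega>) * h (X (2*m) \<omega>, X (2*m+1) \<omega>))
       = expectation (\<lambda>\<omega>. (\<integral>yz. h yz \<partial>P (X n \<omega>)) * (\<integral>yz. h yz \<partial>P (X m \<omega>)))"
proof -
  have *: "(\<Prod>k\<in>Gen r. if k \<in> {n, m} then g k else 1) = g n * g m" for g :: "nat \<Rightarrow> real"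
  proof -
    have "(\<Prod>k\<in>Gen r. if k \<in> {n, m} then g k else 1) = (\<Prod>k\<in>{n, m}. g k)"
      using nm by (subst prod.inter_restrict[symmetric]) (auto intro: prod.cong)
    then show ?thesis using nm by simp
  qed
  have "expectation (\<lambda>\<omega>. \<Prod>k\<in>Gen r. (if k \<in> {n, m} then h else (\<lambda>_. 1)) (X (2*k) \<omega>, X (2*k+1) \<omega>))
       = expectation (\<lambda>\<omega>. \<Prod>k\<in>Gen r. \<integral>yz. (if k \<in> {n, m} then h else (\<lambda>_. 1)) yz \<partial>P (X k \<omega>))"
    using bounded by (intro expectation_prod_Gen[where B="max B 1"]) (auto simp: le_max_iff_disj)
  also have "(\<lambda>\<omega>. \<Prod>k\<in>Gen r. (if k \<in> {n, m} then h else (\<lambda>_. 1)) (X (2*k) \<omega>, X (2*k+1) \<omega>))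
      = (\<lambda>\<omega>. \<Prod>k\<in>Gen r. if k \<in> {n, m} then h (X (2*k) \<omega>, X (2*k+1) \<omega>) else 1)"
    by (intro ext prod.cong) auto
  also have "(\<lambda>\<omega>. \<Prod>k\<in>Gen r. \<integral>yz. (if k \<in> {n, m} then h else (\<lambda>_. 1)) yz \<partial>P (X k \<omega>))
      = (\<lambda>\<omega>. \<Prod>k\<in>Gen r. if k \<in> {n, m} then \<integral>yz. h yz \<partial>P (X k \<omega>) else 1)"
    by (intro ext prod.cong) auto
  finally show ?thesis
    unfolding * .
qed

text \<open>Indicators are bounded, so \<open>expectation_daughters\<close> already determines the
  joint law of two sisters. As an equality of measures it then applies to unbounded nonnegative
  functions without truncation.\<close>

lemma law_daughters:
  assumes n: "n \<in> Gen r"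
  shows "distr M (borel \<Otimes>\<^sub>M borel) (\<lambda>\<omega>. (X (2*n) \<omega>, X (2*n+1) \<omega>)) = distr M borel (X n) \<bind> P"
proof (rule measure_eqI)
  have sp: "space (distr M borel (X n)) \<noteq> {}" by simp
  have P: "P \<in> distr M borel (X n) \<rightarrow>\<^sub>M subprob_algebra (borel \<Otimes>\<^sub>M borel)" by simp
  show "sets (distr M (borel \<Otimes>\<^sub>M borel) (\<lambda>\<omega>. (X (2*n) \<omega>, X (2*n+1) \<omega>))) = sets (distr M borel (X n) \<bind> P)"
    using sets_bind_measurable[OF P sp] by simp
  fix A assume "A \<in> sets (distr M (borel \<Otimes>\<^sub>M borel) (\<lambda>\<omega>. (X (2*n) \<omega>, X (2*n+1) \<omega>)))"
  then have A [measurable]: "A \<in> sets (borel \<Otimes>\<^sub>M borel)" by simp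
  let ?D = "\<lambda>\<omega>. (X (2*n) \<omega>, X (2*n+1) \<omega>)"
  have "emeasure (distr M (borel \<Otimes>\<^sub>M borel) ?D) A = ennreal (prob (?D -` A \<inter> space M))"
    by (simp add: emeasure_distr emeasure_eq_measure)
  also have "prob (?D -` A \<inter> space M) = expectation (\<lambda>\<omega>. indicator A (?D \<omega>))"
    using Bochner_Integration.integral_indicator[of M "?D -` A"]
    by (simp add: indicator_def[abs_def] vimage_def)
  also have "\<dots> = expectation (\<lambda>\<omega>. measure (P (X n \<omega>)) A)"
    using expectation_daughters[OF n, of "indicator A" 1] A sets_P
    by (simp add: indicator_def[abs_def] flip: indicator_def[abs_def])
  also have "ennreal \<dots> = (\<integral>\<^sup>+\<omega>. ennreal (measure (P (X n \<omega>)) A) \<partial>M)"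
  proof (rule nn_integral_eq_integral[symmetric])
    have "(\<lambda>x. measure (P x) A) \<in> borel_measurable borel"
      by measurable
    then show "integrable M (\<lambda>\<omega>. measure (P (X n \<omega>)) A)"
      by (intro integrable_const_bound[where B=1]) (auto simp: prob_space.prob_le_1[OF prob_P])
  qed simp
  also have "\<dots> = (\<integral>\<^sup>+\<omega>. emeasure (P (X n \<omega>)) A \<partial>M)"
    using prob_P by (intro nn_integral_cong finite_measure.emeasure_eq_measure[symmetric])
      (simp add: prob_space.finite_measure)
  also have "\<dots> = emeasure (distr M borel (X n) \<bind> P) A"
    by (simp add: emeasure_bind[OF sp P A] nn_integral_distr)
  finally show "emeasure (distr M (borel \<Otimes>\<^sub>M borel) ?D) A = emeasure (distr M borel (X n) \<bind> P) A" .
qed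

lemma nn_integral_daughters:
  assumes n: "n \<in> Gen r" and [measurable]: "h \<in> borel_measurable (borel \<Otimes>\<^sub>M borel)"
  shows "(\<integral>\<^sup>+\<omega>. h (X (2*n) \<omega>, X (2*n+1) \<omega>) \<partial>M) = (\<integral>\<^sup>+\<omega>. \<integral>\<^sup>+yz. h yz \<partial>P (X n \<omega>) \<partial>M)"
proof -
  have "(\<integral>\<^sup>+\<omega>. h (X (2*n) \<omega>, X (2*n+1) \<omega>) \<partial>M)
      = (\<integral>\<^sup>+yz. h yz \<partial>distr M (borel \<Otimes>\<^sub>M borel) (\<lambda>\<omega>. (X (2*n) \<omega>, X (2*n+1) \<omega>)))"
    by (simp add: nn_integral_distr)
  also have "\<dots> = (\<integral>\<^sup>+x. \<integral>\<^sup>+yz. h yz \<partial>P x \<partial>distr M borel (X n))"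
    unfolding law_daughters[OF n]
    by (rule nn_integral_bind[where B = "borel \<Otimes>\<^sub>M borel"]) (use assms in simp_all)
  also have "\<dots> = (\<integral>\<^sup>+\<omega>. \<integral>\<^sup>+yz. h yz \<partial>P (X n \<omega>) \<partial>M)"
    by (rule nn_integral_distr) simp_all
  finally show ?thesis .
qed

text \<open>\<open>Qop\<close> governs only the sum over both sisters. For nonnegative
  \<open>u\<close> each summand is dominated by that sum, which gives separate
  integrability.\<close>

lemma daughters_nonneg:
  assumes n: "n \<in> Gen r" and u: "u \<in> F" "\<And>x. 0 \<le> u x"
    and int: "integrable M (\<lambda>\<omega>. Qop u (X n \<omega>))"
  shows "integrable M (\<lambda>\<omega>. u (X (2*n) \<omega>))" (is ?A)
    and "integrable M (\<lambda>\<omega>. u (X (2*n+1) \<omega>))" (is ?B)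
    and "expectation (\<lambda>\<omega>. u (X (2*n) \<omega>)) + expectation (\<lambda>\<omega>. u (X (2*n+1) \<omega>))
       = 2 * expectation (\<lambda>\<omega>. Qop u (X n \<omega>))" (is ?C)
proof -
  have [measurable]: "u \<in> borel_measurable borel" using u by auto
  let ?g = "\<lambda>\<omega>. u (X (2*n) \<omega>) + u (X (2*n+1) \<omega>)"
  have "(\<integral>\<^sup>+\<omega>. ennreal (?g \<omega>) \<partial>M) = (\<integral>\<^sup>+\<omega>. ennreal (2 * Qop u (X n \<omega>)) \<partial>M)"
    using nn_integral_daughters[OF n, of "\<lambda>yz. ennreal (u (fst yz) + u (snd yz))"]
    by (simp add: nn_integral_P[OF u])
  also have "\<dots> = ennreal (expectation (\<lambda>\<omega>. 2 * Qop u (X n \<omega>)))"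
    using int Qop_nonneg[of u] u by (intro nn_integral_eq_integral) auto
  finally have eq: "(\<integral>\<^sup>+\<omega>. ennreal (?g \<omega>) \<partial>M) = ennreal (expectation (\<lambda>\<omega>. 2 * Qop u (X n \<omega>)))" .
  have g: "integrable M ?g"
    by (rule integrableI_nn_integral_finite[OF _ _ eq]) (simp_all add: u)
  show AB: ?A ?B
    by (rule Bochner_Integration.integrable_bound[OF g]; simp add: u)+
  have "ennreal (expectation ?g) = ennreal (expectation (\<lambda>\<omega>. 2 * Qop u (X n \<omega>)))"
    using nn_integral_eq_integral[OF g] eq u by simp
  moreover have "0 \<le> expectation ?g" "0 \<le> expectation (\<lambda>\<omega>. 2 * Qop u (X n \<omega>))"
    using u Qop_nonneg[of u] by (auto intro!: integral_nonneg_AE)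
  ultimately have "expectation ?g = expectation (\<lambda>\<omega>. 2 * Qop u (X n \<omega>))"
    by simp
  then show ?C using AB by simp
qed

text \<open>Starts from condition (vi) at the root; integrability of \<open>Qop p\<close> at the
  mother yields that of a nonnegative \<open>p\<close> at each daughter, and \<open>F_cases\<close>
  removes the sign restriction.\<close>

lemma integrable_F_X:
  assumes "n \<in> Gen r" "u \<in> F"
  shows "integrable M (\<lambda>\<omega>. u (X n \<omega>))"
  using assms
proof (induction r arbitrary: n u)
  case 0
  then have [measurable]: "u \<in> borel_measurable borel" by auto
  have "integrable (distr M borel (X 1)) u"
    using F_initial 0 law_root by simp
  with 0 show ?case
    by (simp add: integrable_distr_eq)
next
  case (Suc r)
  define m where "m = n div 2"
  have m: "m \<in> Gen r" "n = 2*m \<or> n = 2*m+1"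
    using Suc.prems(1) by (auto simp: Gen_def m_def)
  have nonneg: "integrable M (\<lambda>\<omega>. p (X n \<omega>))" if "p \<in> F" "\<And>x. 0 \<le> p x" for p
    using m(2) daughters_nonneg(1,2)[OF m(1) that Suc.IH[OF m(1) Qop_F[OF that(1)]]] by auto
  obtain p q where pq: "p \<in> F" "q \<in> F" "\<And>x. 0 \<le> p x" "\<And>x. 0 \<le> q x" "u = (\<lambda>x. p x - q x)"
    using F_cases[OF Suc.prems(2)] by metis
  show ?case
    unfolding pq(5) by (intro Bochner_Integration.integrable_diff nonneg pq)
qed

text \<open>Many-to-one formula: at a uniformly chosen vertex of generation \<open>r\<close> the
  chain has the law of \<open>Y_r\<close> started from \<nu>.\<close>

lemma sum_Gen_F:
  assumes "u \<in> F" "\<And>x. 0 \<le> u x"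
  shows "(\<Sum>n\<in>Gen r. expectation (\<lambda>\<omega>. u (X n \<omega>))) = 2^r * (\<integral>x. (Qop ^^ r) u x \<partial>\<nu>)"
  using assms
proof (induction r arbitrary: u)
  case 0
  then have [measurable]: "u \<in> borel_measurable borel" by auto
  show ?case
    unfolding law_root[symmetric] by (simp add: integral_distr)
next
  case (Suc r)
  have "(\<Sum>n\<in>Gen (Suc r). expectation (\<lambda>\<omega>. u (X n \<omega>)))
      = (\<Sum>n\<in>Gen r. 2 * expectation (\<lambda>\<omega>. Qop u (X n \<omega>)))"
    unfolding sum_Gen_Suc
    by (intro sum.cong refl daughters_nonneg(3) Suc.prems integrable_F_X Qop_F)
  also have "\<dots> = 2 * (2^r * (\<integral>x. (Qop ^^ r) (Qop u) x \<partial>\<nu>))"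
    unfolding sum_distrib_left[symmetric]
    by (subst Suc.IH) (auto intro: Qop_F Qop_nonneg Suc.prems)
  finally show ?case by (simp add: funpow_swap1)
qed

section \<open>Second moments of generation sums\<close>

lemma square_integrable_F_X:
  assumes "n \<in> Gen r" "u \<in> F"
  shows "integrable M (\<lambda>\<omega>. (u (X n \<omega>))\<^sup>2)"
  using integrable_F_X[OF assms(1) F_square[OF assms(2)]] .

lemma integrable_product:
  fixes g h :: "'w \<Rightarrow> real"
  assumes [measurable]: "g \<in> borel_measurable M" "h \<in> borel_measurable M"
    and "integrable M (\<lambda>\<omega>. (g \<omega>)\<^sup>2)" "integrable M (\<lambda>\<omega>. (h \<omega>)\<^sup>2)"
  shows "integrable M (\<lambda>\<omega>. g \<omega> * h \<omega>)"
proof (rule Bochner_Integration.integrable_bound)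
  show "integrable M (\<lambda>\<omega>. (g \<omega>)\<^sup>2 + (h \<omega>)\<^sup>2)"
    using assms by simp
  show "AE \<omega> in M. norm (g \<omega> * h \<omega>) \<le> norm ((g \<omega>)\<^sup>2 + (h \<omega>)\<^sup>2)"
  proof (intro AE_I2)
    fix \<omega>
    have "0 \<le> (\<bar>g \<omega>\<bar> - \<bar>h \<omega>\<bar>)\<^sup>2" by simp
    then have "2 * (\<bar>g \<omega>\<bar> * \<bar>h \<omega>\<bar>) \<le> (g \<omega>)\<^sup>2 + (h \<omega>)\<^sup>2"
      by (simp add: power2_eq_square algebra_simps)
    moreover have "0 \<le> \<bar>g \<omega>\<bar> * \<bar>h \<omega>\<bar>" by simp
    ultimately show "norm (g \<omega> * h \<omega>) \<le> norm ((g \<omega>)\<^sup>2 + (h \<omega>)\<^sup>2)"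
      unfolding real_norm_def abs_mult by linarith
  qed
qed measurable

lemma integrable_F_product:
  assumes "n \<in> Gen r" "m \<in> Gen q" "u \<in> F" "w \<in> F"
  shows "integrable M (\<lambda>\<omega>. u (X n \<omega>) * w (X m \<omega>))"
proof -
  have [measurable]: "u \<in> borel_measurable borel" "w \<in> borel_measurable borel" using assms by auto
  show ?thesis
    by (intro integrable_product square_integrable_F_X[OF assms(1,3)] square_integrable_F_X[OF assms(2,4)]) simp_all
qed

lemma daughter_Gen: "n \<in> Gen r \<Longrightarrow> 2*n \<in> Gen (Suc r)" "n \<in> Gen r \<Longrightarrow> 2*n+1 \<in> Gen (Suc r)"
  by (auto simp: Gen_def)

text \<open>Truncation makes \<open>expectation_two_families\<close> applicable; dominated
  convergence is then used twice, under \<open>P x\<close> and under the expectation. Each mother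
  contributes \<open>2 * Qop u\<close>, hence the \<open>4\<close>.\<close>

lemma expectation_cross:
  assumes nm: "n \<in> Gen r" "m \<in> Gen r" "n \<noteq> m" and u: "u \<in> F"
  shows "expectation (\<lambda>\<omega>. (u (X (2*n) \<omega>) + u (X (2*n+1) \<omega>)) * (u (X (2*m) \<omega>) + u (X (2*m+1) \<omega>)))
       = 4 * expectation (\<lambda>\<omega>. Qop u (X n \<omega>) * Qop u (X m \<omega>))"
proof -
  obtain w where w: "w \<in> F" "\<And>x. \<bar>u x\<bar> \<le> w x"
    using F_dominated[OF u] by blast
  have [measurable]: "u \<in> borel_measurable borel" "w \<in> borel_measurable borel" using u w by auto
  define t :: "nat \<Rightarrow> 's \<Rightarrow> real" where "t k x = max (- real k) (min (real k) (u x))" for k x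
  have [measurable]: "t k \<in> borel_measurable borel" for k
    unfolding t_def by measurable
  have t_le: "\<bar>t k x\<bar> \<le> \<bar>u x\<bar>" "\<bar>t k x\<bar> \<le> k" for k x
    by (auto simp: t_def)
  have t_w: "\<bar>t k x\<bar> \<le> w x" for k x
    using t_le(1) w(2) order_trans by blast
  have t_lim: "(\<lambda>k. t k x) \<longlonglongrightarrow> u x" for x
  proof (rule tendsto_eventually)
    obtain K :: nat where "\<bar>u x\<bar> \<le> K" using real_arch_simple by blast
    then have "t k x = u x" if "k \<ge> K" for k
      using that by (auto simp: t_def min_def max_def abs_le_iff)
    then show "\<forall>\<^sub>F k in sequentially. t k x = u x"
      by (auto simp: eventually_sequentially)
  qed
  define h where "h k yz = t k (fst yz) + t k (snd yz)" for k and yz :: "'s \<times> 's"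
  have [measurable]: "h k \<in> borel_measurable (borel \<Otimes>\<^sub>M borel)" for k
    unfolding h_def by measurable
  have h_w: "\<bar>h k yz\<bar> \<le> w (fst yz) + w (snd yz)" for k yz
    using t_w[of k "fst yz"] t_w[of k "snd yz"] by (simp add: h_def abs_le_iff)
  define H where "H k x = (\<integral>yz. h k yz \<partial>P x)" for k x
  have [measurable]: "H k \<in> borel_measurable borel" for k
    unfolding H_def by measurable
  have w_int: "integrable (P x) (\<lambda>yz. w (fst yz) + w (snd yz))" for x
    using integrable_P_fst[OF w(1)] integrable_P_snd[OF w(1)] by simp
  have h_int: "integrable (P x) (h k)" for k x
    by (rule Bochner_Integration.integrable_bound[OF w_int])
      (use h_w in \<open>auto intro!: order_trans[OF h_w abs_ge_self]\<close>)
  \<comment> \<open>The majorant is free of \<open>k\<close> and lies in \<open>F\<close>, so it is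
    square integrable along the chain and dominates the outer limit.\<close>
  have H_w: "\<bar>H k x\<bar> \<le> 2 * Qop w x" for k x
  proof -
    have "\<bar>H k x\<bar> \<le> (\<integral>yz. \<bar>h k yz\<bar> \<partial>P x)"
      unfolding H_def by (rule integral_abs_bound)
    also have "\<dots> \<le> (\<integral>yz. w (fst yz) + w (snd yz) \<partial>P x)"
      using h_int by (intro integral_mono w_int h_w) auto
    finally show ?thesis by (simp add: Qop_def)
  qed
  have H_lim: "(\<lambda>k. H k x) \<longlonglongrightarrow> 2 * Qop u x" for x
  proof -
    have "(\<lambda>k. \<integral>yz. h k yz \<partial>P x) \<longlonglongrightarrow> (\<integral>yz. u (fst yz) + u (snd yz) \<partial>P x)"
    proof (rule integral_dominated_convergence[OF _ _ w_int])
      show "AE yz in P x. (\<lambda>k. h k yz) \<longlonglongrightarrow> u (fst yz) + u (snd yz)"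
        unfolding h_def by (intro AE_I2 tendsto_add t_lim)
      show "AE yz in P x. norm (h k yz) \<le> w (fst yz) + w (snd yz)" for k
        using h_w by simp
    qed simp_all
    then show ?thesis by (simp add: H_def Qop_def)
  qed
  note gen = daughter_Gen[OF nm(1)] daughter_Gen[OF nm(2)]
  let ?D = "\<lambda>n \<omega>. (X (2*n) \<omega>, X (2*n+1) \<omega>)"
  have lhs: "(\<lambda>k. expectation (\<lambda>\<omega>. h k (?D n \<omega>) * h k (?D m \<omega>)))
      \<longlonglongrightarrow> expectation (\<lambda>\<omega>. (u (X (2*n) \<omega>) + u (X (2*n+1) \<omega>)) * (u (X (2*m) \<omega>) + u (X (2*m+1) \<omega>)))"
  proof (rule integral_dominated_convergence)
    show "integrable M (\<lambda>\<omega>. (w (X (2*n) \<omega>) + w (X (2*n+1) \<omega>)) * (w (X (2*m) \<omega>) + w (X (2*m+1) \<omega>)))"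
      unfolding distrib_left distrib_right
      by (intro Bochner_Integration.integrable_add integrable_F_product[of _ "Suc r" _ "Suc r"] w gen)
    show "AE \<omega> in M. norm (h k (?D n \<omega>) * h k (?D m \<omega>))
        \<le> (w (X (2*n) \<omega>) + w (X (2*n+1) \<omega>)) * (w (X (2*m) \<omega>) + w (X (2*m+1) \<omega>))" for k
      unfolding real_norm_def abs_mult
      using h_w[of k "?D n _"] h_w[of k "?D m _"] by (intro AE_I2 mult_mono') auto
    show "AE \<omega> in M. (\<lambda>k. h k (?D n \<omega>) * h k (?D m \<omega>))
        \<longlonglongrightarrow> (u (X (2*n) \<omega>) + u (X (2*n+1) \<omega>)) * (u (X (2*m) \<omega>) + u (X (2*m+1) \<omega>))"
      unfolding h_def by (intro AE_I2 tendsto_mult) (auto intro!: tendsto_add t_lim)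
  qed simp_all
  have rhs: "(\<lambda>k. expectation (\<lambda>\<omega>. H k (X n \<omega>) * H k (X m \<omega>)))
      \<longlonglongrightarrow> expectation (\<lambda>\<omega>. (2 * Qop u (X n \<omega>)) * (2 * Qop u (X m \<omega>)))"
  proof (rule integral_dominated_convergence)
    have [measurable]: "Qop u \<in> borel_measurable borel" using Qop_F[OF u] by auto
    show "(\<lambda>\<omega>. (2 * Qop u (X n \<omega>)) * (2 * Qop u (X m \<omega>))) \<in> borel_measurable M"
      by measurable
    show "integrable M (\<lambda>\<omega>. (2 * Qop w (X n \<omega>)) * (2 * Qop w (X m \<omega>)))"
      by (rule integrable_F_product[OF nm(1,2)]) (intro F_smult Qop_F w)+
    show "AE \<omega> in M. norm (H k (X n \<omega>) * H k (X m \<omega>))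
        \<le> (2 * Qop w (X n \<omega>)) * (2 * Qop w (X m \<omega>))" for k
      unfolding real_norm_def abs_mult using H_w by (intro AE_I2 mult_mono') auto
    show "AE \<omega> in M. (\<lambda>k. H k (X n \<omega>) * H k (X m \<omega>))
        \<longlonglongrightarrow> (2 * Qop u (X n \<omega>)) * (2 * Qop u (X m \<omega>))"
      by (intro AE_I2 tendsto_mult H_lim)
  qed simp
  have "expectation (\<lambda>\<omega>. h k (?D n \<omega>) * h k (?D m \<omega>)) = expectation (\<lambda>\<omega>. H k (X n \<omega>) * H k (X m \<omega>))" for k
    unfolding H_def
  proof (rule expectation_two_families[OF nm, where B = "2 * real k"])
    show "\<bar>h k yz\<bar> \<le> 2 * real k" for yz
      using t_le(2)[of k "fst yz"] t_le(2)[of k "snd yz"] by (simp add: h_def abs_le_iff)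
  qed simp
  with lhs rhs show ?thesis
    using LIMSEQ_unique by fastforce
qed

text \<open>Pairs of distinct mothers contribute exactly \<open>4\<close> times the matching term
  for \<open>Qop u\<close>. In a diagonal term the sisters may be dependent, so it is bounded by
  twice the sum of their squares.\<close>

lemma second_moment_Suc:
  assumes u: "u \<in> F"
  shows "expectation (\<lambda>\<omega>. (\<Sum>n\<in>Gen (Suc r). u (X n \<omega>))\<^sup>2)
    \<le> 4 * expectation (\<lambda>\<omega>. (\<Sum>n\<in>Gen r. Qop u (X n \<omega>))\<^sup>2)
      + 4 * (2^r * (\<integral>x. (Qop ^^ Suc r) (\<lambda>x. (u x)\<^sup>2) x \<partial>\<nu>))"
proof -
  define Y where "Y n \<omega> = u (X (2*n) \<omega>) + u (X (2*n+1) \<omega>)" for n \<omega>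
  define H where "H n \<omega> = Qop u (X n \<omega>)" for n \<omega>
  define V where "V = (\<lambda>x. (u x)\<^sup>2)"
  have V: "V \<in> F" "\<And>x. 0 \<le> V x" using u F_square by (auto simp: V_def)
  note int = integrable_F_product[of _ "Suc r" _ "Suc r", OF _ _ u u]
  have intY: "integrable M (\<lambda>\<omega>. Y n \<omega> * Y m \<omega>)" if "n \<in> Gen r" "m \<in> Gen r" for n m
    unfolding Y_def distrib_left distrib_right
    by (intro Bochner_Integration.integrable_add int daughter_Gen that)
  have intH: "integrable M (\<lambda>\<omega>. H n \<omega> * H m \<omega>)" if "n \<in> Gen r" "m \<in> Gen r" for n m
    unfolding H_def by (intro integrable_F_product[OF that] Qop_F u)
  have diag: "expectation (\<lambda>\<omega>. (Y n \<omega>)\<^sup>2) \<le> 4 * expectation (\<lambda>\<omega>. Qop V (X n \<omega>))" if n: "n \<in> Gen r" for n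
  proof -
    have i: "integrable M (\<lambda>\<omega>. V (X (2*n) \<omega>))" "integrable M (\<lambda>\<omega>. V (X (2*n+1) \<omega>))"
      by (rule integrable_F_X[OF daughter_Gen(1)[OF n] V(1)] integrable_F_X[OF daughter_Gen(2)[OF n] V(1)])+
    have "expectation (\<lambda>\<omega>. (Y n \<omega>)\<^sup>2) \<le> expectation (\<lambda>\<omega>. 2 * (V (X (2*n) \<omega>) + V (X (2*n+1) \<omega>)))"
    proof (rule integral_mono)
      fix \<omega>
      show "(Y n \<omega>)\<^sup>2 \<le> 2 * (V (X (2*n) \<omega>) + V (X (2*n+1) \<omega>))"
        using zero_le_power2[of "u (X (2*n) \<omega>) - u (X (2*n+1) \<omega>)"]
        by (simp add: Y_def V_def power2_eq_square algebra_simps)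
    qed (use intY[OF n n] i in \<open>simp_all add: power2_eq_square\<close>)
    also have "\<dots> = 2 * (expectation (\<lambda>\<omega>. V (X (2*n) \<omega>)) + expectation (\<lambda>\<omega>. V (X (2*n+1) \<omega>)))"
      using i by simp
    also have "\<dots> = 4 * expectation (\<lambda>\<omega>. Qop V (X n \<omega>))"
      using daughters_nonneg(3)[OF n V integrable_F_X[OF n Qop_F[OF V(1)]]] by simp
    finally show ?thesis .
  qed
  have expand: "expectation (\<lambda>\<omega>. (\<Sum>n\<in>Gen r. Z n \<omega>)\<^sup>2)
      = (\<Sum>n\<in>Gen r. expectation (\<lambda>\<omega>. (Z n \<omega>)\<^sup>2))
        + (\<Sum>(n, m)\<in>off_diagonal (Gen r). expectation (\<lambda>\<omega>. Z n \<omega> * Z m \<omega>))"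
    if Z: "\<And>n m. n \<in> Gen r \<Longrightarrow> m \<in> Gen r \<Longrightarrow> integrable M (\<lambda>\<omega>. Z n \<omega> * Z m \<omega>)"
    for Z :: "nat \<Rightarrow> 'w \<Rightarrow> real"
  proof -
    have sq: "integrable M (\<lambda>\<omega>. (Z n \<omega>)\<^sup>2)" if "n \<in> Gen r" for n
      using Z[OF that that] by (simp add: power2_eq_square)
    have off: "integrable M (\<lambda>\<omega>. Z (fst nm) \<omega> * Z (snd nm) \<omega>)" if "nm \<in> off_diagonal (Gen r)" for nm
      using that Z by (auto simp: off_diagonal_def)
    show ?thesis
      unfolding sum_square_off_diagonal[OF finite_Gen] split_def
      using sq off
      by (simp add: Bochner_Integration.integral_sum Bochner_Integration.integrable_sum)
  qed
  have "expectation (\<lambda>\<omega>. (\<Sum>n\<in>Gen (Suc r). u (X n \<omega>))\<^sup>2) = expectation (\<lambda>\<omega>. (\<Sum>n\<in>Gen r. Y n \<omega>)\<^sup>2)"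
    by (simp add: sum_Gen_Suc Y_def)
  also have "\<dots> = (\<Sum>n\<in>Gen r. expectation (\<lambda>\<omega>. (Y n \<omega>)\<^sup>2))
        + (\<Sum>(n, m)\<in>off_diagonal (Gen r). expectation (\<lambda>\<omega>. Y n \<omega> * Y m \<omega>))"
    by (rule expand[OF intY])
  also have "(\<Sum>(n, m)\<in>off_diagonal (Gen r). expectation (\<lambda>\<omega>. Y n \<omega> * Y m \<omega>))
      = 4 * (\<Sum>(n, m)\<in>off_diagonal (Gen r). expectation (\<lambda>\<omega>. H n \<omega> * H m \<omega>))"
    unfolding sum_distrib_left split_def
  proof (rule sum.cong[OF refl])
    fix nm assume "nm \<in> off_diagonal (Gen r)"
    then show "expectation (\<lambda>\<omega>. Y (fst nm) \<omega> * Y (snd nm) \<omega>)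
        = 4 * expectation (\<lambda>\<omega>. H (fst nm) \<omega> * H (snd nm) \<omega>)"
      unfolding Y_def H_def by (intro expectation_cross[of _ r] u) (auto simp: off_diagonal_def)
  qed
  also have "\<dots> = 4 * (expectation (\<lambda>\<omega>. (\<Sum>n\<in>Gen r. H n \<omega>)\<^sup>2) - (\<Sum>n\<in>Gen r. expectation (\<lambda>\<omega>. (H n \<omega>)\<^sup>2)))"
    using expand[OF intH] by simp
  also have "\<dots> \<le> 4 * expectation (\<lambda>\<omega>. (\<Sum>n\<in>Gen r. H n \<omega>)\<^sup>2)"
    by (simp add: sum_nonneg)
  also have "(\<Sum>n\<in>Gen r. expectation (\<lambda>\<omega>. (Y n \<omega>)\<^sup>2)) \<le> 4 * (2^r * (\<integral>x. (Qop ^^ Suc r) V x \<partial>\<nu>))"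
  proof -
    have "(\<Sum>n\<in>Gen r. expectation (\<lambda>\<omega>. (Y n \<omega>)\<^sup>2)) \<le> 4 * (\<Sum>n\<in>Gen r. expectation (\<lambda>\<omega>. Qop V (X n \<omega>)))"
      unfolding sum_distrib_left by (intro sum_mono diag)
    also have "(\<Sum>n\<in>Gen r. expectation (\<lambda>\<omega>. Qop V (X n \<omega>))) = 2^r * (\<integral>x. (Qop ^^ r) (Qop V) x \<partial>\<nu>)"
      by (intro sum_Gen_F Qop_F Qop_nonneg V)
    finally show ?thesis by (simp add: funpow_swap1)
  qed
  finally show ?thesis
    by (simp add: H_def V_def add.commute)
qed

lemma Qop_mono:
  assumes "u \<in> F" "w \<in> F" "\<And>x. u x \<le> w x"
  shows "Qop u x \<le> Qop w x"
proof -
  have "(\<integral>yz. u (fst yz) + u (snd yz) \<partial>P x) \<le> (\<integral>yz. w (fst yz) + w (snd yz) \<partial>P x)"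
    using assms
    by (intro integral_mono Bochner_Integration.integrable_add integrable_P_fst integrable_P_snd add_mono)
  then show ?thesis by (simp add: Qop_def)
qed

lemma Qop_funpow_mono:
  assumes "u \<in> F" "w \<in> F" "\<And>x. u x \<le> w x"
  shows "(Qop ^^ k) u x \<le> (Qop ^^ k) w x"
proof (induction k arbitrary: x)
  case (Suc k)
  show ?case
    unfolding funpow.simps o_def by (intro Qop_mono Qop_funpow_F assms Suc)
qed (simp add: assms)

lemma Qop_scale: "Qop (\<lambda>x. c * u x) = (\<lambda>x. c * Qop u x)"
  by (simp add: Qop_def fun_eq_iff flip: distrib_left)

text \<open>Replacing \<open>u\<close> by \<open>Qop u\<close> preserves the decay hypothesis with
  the same \<open>g\<close> and with \<alpha> absorbed into \<open>A\<close>, so \<open>A\<close>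
  must vary in the induction. Writing \<open>K\<close> for the bracket, the step needs
  \<open>\<alpha>\<^sup>2 * K * b^r + (1/2)^r \<le> K * b^(r+1)\<close>, which follows from
  \<open>(b - \<alpha>\<^sup>2) * K \<ge> 1\<close>; the summand \<open>1\<close> in
  \<open>K\<close> serves \<open>r = 0\<close>. Keeping \<open>b\<close> strictly above \<alpha>^2
  avoids the factor \<open>r\<close> of the resonant case \<alpha>^2 = 1/2.\<close>

lemma second_moment_generation:
  assumes g: "g \<in> F" and C: "\<And>r. (\<integral>x. (Qop ^^ r) (\<lambda>x. (g x)\<^sup>2) x \<partial>\<nu>) \<le> C"
    and \<alpha>: "0 \<le> \<alpha>" "\<alpha>\<^sup>2 < b" "1/2 \<le> b"
    and u: "u \<in> F" and decay: "\<And>k x. \<bar>(Qop ^^ k) u x\<bar> \<le> A * \<alpha> ^ k * g x"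
  shows "expectation (\<lambda>\<omega>. (\<Sum>n\<in>Gen r. u (X n \<omega>))\<^sup>2) \<le> 4^r * (A\<^sup>2 * C * ((1 + 1 / (b - \<alpha>\<^sup>2)) * b ^ r))"
  using u decay
proof (induction r arbitrary: u A)
  case (0 u A)
  have [measurable]: "u \<in> borel_measurable borel" using 0 by auto
  have C0: "0 \<le> C" using C[of 0] by (rule order_trans[rotated]) simp
  have "expectation (\<lambda>\<omega>. (u (X 1 \<omega>))\<^sup>2) = (\<integral>x. (u x)\<^sup>2 \<partial>\<nu>)"
    unfolding law_root[symmetric] by (simp add: integral_distr)
  also have "\<dots> \<le> (\<integral>x. A\<^sup>2 * (g x)\<^sup>2 \<partial>\<nu>)"
  proof (rule integral_mono)
    \<comment> \<open>Decay at \<open>k = 0\<close>, squared; it reduces every \<open>u\<close> to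
      the fixed function \<open>g\<close> and its bound \<open>C\<close>.\<close>
    show "(u x)\<^sup>2 \<le> A\<^sup>2 * (g x)\<^sup>2" for x
      using power_mono[OF 0(2)[of 0 x], of 2] by (simp add: power_mult_distrib)
  qed (intro F_initial F_smult F_square 0 g)+
  also have "\<dots> \<le> A\<^sup>2 * C"
    using C[of 0] by (simp add: mult_left_mono)
  also have "\<dots> \<le> A\<^sup>2 * C * (1 + 1 / (b - \<alpha>\<^sup>2))"
    using mult_left_mono[of 1 "1 + 1 / (b - \<alpha>\<^sup>2)" "A\<^sup>2 * C"] C0 \<alpha> by simp
  finally show ?case by simp
next
  case (Suc r u A)
  define K where "K = 1 + 1 / (b - \<alpha>\<^sup>2)"
  define V where "V = (\<lambda>x. (u x)\<^sup>2)"
  define W where "W = (\<lambda>x. A\<^sup>2 * (g x)\<^sup>2)"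
  have C0: "0 \<le> C"
    using C[of 0] by (rule order_trans[rotated]) simp
  have VW: "V \<in> F" "W \<in> F" by (auto simp: V_def W_def intro!: F_square F_smult Suc g)
  have IH: "expectation (\<lambda>\<omega>. (\<Sum>n\<in>Gen r. Qop u (X n \<omega>))\<^sup>2) \<le> 4^r * ((A * \<alpha>)\<^sup>2 * C * (K * b ^ r))"
    unfolding K_def
  proof (rule Suc.IH)
    show "\<bar>(Qop ^^ k) (Qop u) x\<bar> \<le> A * \<alpha> * \<alpha> ^ k * g x" for k x
      using Suc.prems(2)[of "Suc k" x] by (simp add: funpow_swap1 mult_ac)
  qed (intro Qop_F Suc.prems)
  have scale: "(Qop ^^ k) W = (\<lambda>x. A\<^sup>2 * (Qop ^^ k) (\<lambda>x. (g x)\<^sup>2) x)" for k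
    by (induction k) (simp_all add: W_def Qop_scale)
  have "(\<integral>x. (Qop ^^ Suc r) V x \<partial>\<nu>) \<le> (\<integral>x. (Qop ^^ Suc r) W x \<partial>\<nu>)"
  proof (intro integral_mono F_initial Qop_funpow_F Qop_funpow_mono VW)
    show "V x \<le> W x" for x
      using power_mono[OF Suc.prems(2)[of 0 x], of 2] by (simp add: V_def W_def power_mult_distrib)
  qed
  also have "\<dots> \<le> A\<^sup>2 * C"
    unfolding scale using C[of "Suc r"] by (simp add: mult_left_mono del: funpow.simps)
  finally have V: "(\<integral>x. (Qop ^^ Suc r) V x \<partial>\<nu>) \<le> A\<^sup>2 * C" .
  have "expectation (\<lambda>\<omega>. (\<Sum>n\<in>Gen (Suc r). u (X n \<omega>))\<^sup>2)
    \<le> 4 * (4^r * ((A * \<alpha>)\<^sup>2 * C * (K * b ^ r))) + 4 * (2^r * (A\<^sup>2 * C))"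
    using second_moment_Suc[OF Suc.prems(1), of r] IH V unfolding V_def
    by (meson add_mono mult_left_mono order_trans zero_le_numeral zero_le_power)
  also have "\<dots> = 4 ^ Suc r * (A\<^sup>2 * C * (\<alpha>\<^sup>2 * (K * b ^ r) + (1/2) ^ r))"
  proof -
    have "(2::real) ^ r = 4 ^ r * (1/2) ^ r"
      by (simp flip: power_mult_distrib)
    then show ?thesis by (simp add: power_mult_distrib algebra_simps)
  qed
  also have "\<dots> \<le> 4 ^ Suc r * (A\<^sup>2 * C * (K * b ^ Suc r))"
  proof (intro mult_left_mono)
    have "(1/2) ^ r \<le> b ^ r" using \<alpha> by (intro power_mono) auto
    also have "b ^ r \<le> (b - \<alpha>\<^sup>2) * K * b ^ r"
    proof -
      have "1 \<le> (b - \<alpha>\<^sup>2) * K" using \<alpha> by (simp add: K_def distrib_left)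
      then have "1 * b ^ r \<le> (b - \<alpha>\<^sup>2) * K * b ^ r"
        using \<alpha> by (intro mult_right_mono) auto
      then show ?thesis by simp
    qed
    finally show "\<alpha>\<^sup>2 * (K * b ^ r) + (1/2) ^ r \<le> K * b ^ Suc r"
      by (simp add: algebra_simps)
  qed (use C0 in auto)
  finally show ?case by (simp add: K_def)
qed

subsection \<open>Sampling the chain along a random permutation\<close>

text \<open>Two distinct positions sample a uniform off-diagonal pair independent of the chain, so
  every cross term has the same mean \<open>(T - m) / card D\<close>. This controls any partial sum
  by the complete sum of its generation.\<close>

lemma second_moment_sample:
  assumes \<pi>: "is_unif_level_perm M \<pi>"
    and indep: "indep_set
                  {(\<lambda>\<omega>. \<pi> \<omega>) -` A \<inter> space M | A. A \<in> sets (Pi\<^sub>M UNIV (\<lambda>_. count_space UNIV))}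
                  {(\<lambda>\<omega> n. X n \<omega>) -` B \<inter> space M | B. B \<in> sets (Pi\<^sub>M UNIV (\<lambda>_. borel))}"
    and u: "u \<in> F" and I: "I \<subseteq> Gen r"
  shows "integrable M (\<lambda>\<omega>. (\<Sum>i\<in>I. u (X (\<pi> \<omega> i) \<omega>))\<^sup>2)"
    and "expectation (\<lambda>\<omega>. (\<Sum>i\<in>I. u (X (\<pi> \<omega> i) \<omega>))\<^sup>2)
      \<le> (\<Sum>a\<in>Gen r. expectation (\<lambda>\<omega>. (u (X a \<omega>))\<^sup>2))
        + expectation (\<lambda>\<omega>. (\<Sum>a\<in>Gen r. u (X a \<omega>))\<^sup>2)"
proof -
  have [measurable]: "u \<in> borel_measurable borel" using u by auto
  have \<pi>_meas [measurable]: "(\<lambda>\<omega>. \<pi> \<omega> i) \<in> M \<rightarrow>\<^sub>M count_space UNIV" for i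
    using \<pi> by (simp add: is_unif_level_perm_def)
  have \<pi>_Gen: "\<pi> \<omega> i \<in> Gen r" if "\<omega> \<in> space M" "i \<in> Gen r" for \<omega> i
    using \<pi> that by (auto simp: is_unif_level_perm_def)
  have \<pi>_inj: "\<pi> \<omega> i = \<pi> \<omega> j \<longleftrightarrow> i = j" if "\<omega> \<in> space M" for \<omega> i j
    using \<pi> that by (auto simp: is_unif_level_perm_def dest!: permutes_inj injD)
  have "(\<lambda>\<omega> i. \<pi> \<omega> i) \<in> M \<rightarrow>\<^sub>M Pi\<^sub>M UNIV (\<lambda>_. count_space UNIV)"
    by (rule measurable_PiM_single') simp_all
  then have [measurable]: "\<pi> \<in> M \<rightarrow>\<^sub>M Pi\<^sub>M UNIV (\<lambda>_. count_space UNIV)"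
    by simp
  have [measurable]: "(\<lambda>\<omega> n. X n \<omega>) \<in> M \<rightarrow>\<^sub>M Pi\<^sub>M UNIV (\<lambda>_. borel)"
    by (rule measurable_PiM_single') simp_all
  have indep_product:
    "integrable M (\<lambda>\<omega>. indicator {\<omega>. E (\<pi> \<omega>)} \<omega> * h (\<lambda>n. X n \<omega>) :: real)
     \<and> expectation (\<lambda>\<omega>. indicator {\<omega>. E (\<pi> \<omega>)} \<omega> * h (\<lambda>n. X n \<omega>))
        = prob {\<omega> \<in> space M. E (\<pi> \<omega>)} * expectation (\<lambda>\<omega>. h (\<lambda>n. X n \<omega>))"
    if E: "Measurable.pred (Pi\<^sub>M UNIV (\<lambda>_. count_space UNIV)) E"
      and h [measurable]: "h \<in> borel_measurable (Pi\<^sub>M UNIV (\<lambda>_. borel))"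
      and h_int: "integrable M (\<lambda>\<omega>. h (\<lambda>n. X n \<omega>))"
    for E :: "(nat \<Rightarrow> nat) \<Rightarrow> bool" and h :: "(nat \<Rightarrow> 's) \<Rightarrow> real"
  proof -
    note E [measurable]
    have iE: "(\<lambda>p. indicator {p. E p} p :: real) \<in> borel_measurable (Pi\<^sub>M UNIV (\<lambda>_. count_space UNIV))"
      unfolding indicator_def of_bool_def mem_Collect_eq by measurable
    have iv: "indep_var borel (\<lambda>\<omega>. indicator {\<omega>. E (\<pi> \<omega>)} \<omega> :: real) borel (\<lambda>\<omega>. h (\<lambda>n. X n \<omega>))"
    proof -
      have "indicator {\<omega>. E (\<pi> \<omega>)} \<omega> = (indicator {p. E p} (\<pi> \<omega>) :: real)" for \<omega>
        by (simp add: indicator_def)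
      then show ?thesis
        using indep_var_if_indep_set_vimage[OF indep _ _ iE h] by simp
    qed
    have ev: "{\<omega> \<in> space M. E (\<pi> \<omega>)} \<in> events" by measurable
    have eq: "expectation (indicator {\<omega>. E (\<pi> \<omega>)}) = prob {\<omega> \<in> space M. E (\<pi> \<omega>)}"
      by (simp add: Int_def conj_commute)
    have "integrable M (indicator {\<omega> \<in> space M. E (\<pi> \<omega>)} :: 'w \<Rightarrow> real)"
      using ev by (simp add: emeasure_eq_measure)
    then have "integrable M (\<lambda>\<omega>. indicator {\<omega>. E (\<pi> \<omega>)} \<omega> :: real)"
      by (rule Bochner_Integration.integrable_cong[THEN iffD1, rotated -1])
        (auto simp: indicator_def)
    from indep_var_lebesgue_integral[OF iv this h_int] indep_var_integrable[OF iv this h_int] eq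
    show ?thesis by simp
  qed
  define m where "m = (\<Sum>a\<in>Gen r. expectation (\<lambda>\<omega>. (u (X a \<omega>))\<^sup>2))"
  define T where "T = expectation (\<lambda>\<omega>. (\<Sum>a\<in>Gen r. u (X a \<omega>))\<^sup>2)"
  define D where "D = off_diagonal (Gen r)"
  have finI [simp]: "finite I" using I by (rule finite_subset) simp
  have sq: "integrable M (\<lambda>\<omega>. (u (X a \<omega>))\<^sup>2)" if "a \<in> Gen r" for a
    using square_integrable_F_X[OF that u] .
  have prd: "integrable M (\<lambda>\<omega>. u (X a \<omega>) * u (X b \<omega>))" if "a \<in> Gen r" "b \<in> Gen r" for a b
    using integrable_F_product[OF that u u] .
  have m0: "0 \<le> m" by (simp add: m_def sum_nonneg)
  have T0: "0 \<le> T" by (simp add: T_def)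
  have T_eq: "T = m + (\<Sum>(a, b)\<in>D. expectation (\<lambda>\<omega>. u (X a \<omega>) * u (X b \<omega>)))"
  proof -
    have "integrable M (\<lambda>\<omega>. u (X (fst ab) \<omega>) * u (X (snd ab) \<omega>))" if "ab \<in> D" for ab
      using that prd by (auto simp: D_def off_diagonal_def)
    then show ?thesis
      unfolding T_def m_def sum_square_off_diagonal[OF finite_Gen] split_def D_def
      using sq by simp
  qed
  have single: "integrable M (\<lambda>\<omega>. (u (X (\<pi> \<omega> i) \<omega>))\<^sup>2)" if i: "i \<in> Gen r" for i
  proof -
    \<comment> \<open>Evaluation at a random index becomes a finite sum over its values, each term
      an event of \<pi> times a function of the chain.\<close>
    have "integrable M (\<lambda>\<omega>. \<Sum>a\<in>Gen r. indicator {\<omega>. \<pi> \<omega> i = a} \<omega> * (u (X a \<omega>))\<^sup>2)"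
      using indep_product[of "\<lambda>p. p i = _" "\<lambda>x. (u (x _))\<^sup>2"] sq
      by (intro Bochner_Integration.integrable_sum) auto
    then show ?thesis
      by (rule Bochner_Integration.integrable_cong[THEN iffD1, rotated -1])
        (auto simp: indicator_def \<pi>_Gen i if_distrib[where f="\<lambda>x. x * _"] cong: if_cong)
  qed
  have pair: "integrable M (\<lambda>\<omega>. u (X (\<pi> \<omega> i) \<omega>) * u (X (\<pi> \<omega> j) \<omega>))
      \<and> expectation (\<lambda>\<omega>. u (X (\<pi> \<omega> i) \<omega>) * u (X (\<pi> \<omega> j) \<omega>)) = (T - m) / card D"
    if ij: "(i, j) \<in> D" for i j
  proof -
    let ?h = "\<lambda>ab \<omega>. indicator {\<omega>. \<pi> \<omega> i = fst ab \<and> \<pi> \<omega> j = snd ab} \<omega> * (u (X (fst ab) \<omega>) * u (X (snd ab) \<omega>))"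
    have h: "integrable M (?h ab) \<and> expectation (?h ab)
        = 1 / card D * expectation (\<lambda>\<omega>. u (X (fst ab) \<omega>) * u (X (snd ab) \<omega>))" if ab: "ab \<in> D" for ab
    proof -
      have "prob {\<omega> \<in> space M. \<pi> \<omega> i = fst ab \<and> \<pi> \<omega> j = snd ab} = 1 / card D"
        using unif_level_perm_pair[OF \<pi>, of i j r "fst ab" "snd ab"] ij ab by (simp add: D_def)
      moreover have "integrable M (\<lambda>\<omega>. u (X (fst ab) \<omega>) * u (X (snd ab) \<omega>))"
        using ab by (intro prd) (auto simp: D_def off_diagonal_def)
      ultimately show ?thesis
        using indep_product[of "\<lambda>p. p i = fst ab \<and> p j = snd ab" "\<lambda>x. u (x (fst ab)) * u (x (snd ab))"]
        by simp
    qed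
    have eq: "u (X (\<pi> \<omega> i) \<omega>) * u (X (\<pi> \<omega> j) \<omega>) = (\<Sum>ab\<in>D. ?h ab \<omega>)" if \<omega>: "\<omega> \<in> space M" for \<omega>
    proof -
      have "(\<pi> \<omega> i, \<pi> \<omega> j) \<in> D"
        using ij \<omega> \<pi>_Gen \<pi>_inj by (auto simp: D_def off_diagonal_def)
      then have "(\<Sum>ab\<in>{(\<pi> \<omega> i, \<pi> \<omega> j)}. ?h ab \<omega>) = (\<Sum>ab\<in>D. ?h ab \<omega>)"
        by (intro sum.mono_neutral_left) (auto simp: D_def indicator_def)
      then show ?thesis by simp
    qed
    have "integrable M (\<lambda>\<omega>. \<Sum>ab\<in>D. ?h ab \<omega>)"
      using h by (intro Bochner_Integration.integrable_sum) auto
    moreover have "expectation (\<lambda>\<omega>. \<Sum>ab\<in>D. ?h ab \<omega>) = (T - m) / card D"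
      using h by (subst Bochner_Integration.integral_sum)
        (auto simp: T_eq split_def sum_divide_distrib intro!: sum.cong)
    moreover have "integrable M (\<lambda>\<omega>. u (X (\<pi> \<omega> i) \<omega>) * u (X (\<pi> \<omega> j) \<omega>)) \<longleftrightarrow> integrable M (\<lambda>\<omega>. \<Sum>ab\<in>D. ?h ab \<omega>)"
      by (intro Bochner_Integration.integrable_cong refl eq)
    moreover have "expectation (\<lambda>\<omega>. u (X (\<pi> \<omega> i) \<omega>) * u (X (\<pi> \<omega> j) \<omega>)) = expectation (\<lambda>\<omega>. \<Sum>ab\<in>D. ?h ab \<omega>)"
      by (intro Bochner_Integration.integral_cong refl eq)
    ultimately show ?thesis by simp
  qed
  let ?Y = "\<lambda>i \<omega>. u (X (\<pi> \<omega> i) \<omega>)"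
  have subD: "off_diagonal I \<subseteq> D" using I by (auto simp: D_def off_diagonal_def)
  have pair': "integrable M (\<lambda>\<omega>. ?Y (fst ij) \<omega> * ?Y (snd ij) \<omega>)
      \<and> expectation (\<lambda>\<omega>. ?Y (fst ij) \<omega> * ?Y (snd ij) \<omega>) = (T - m) / card D" if "ij \<in> off_diagonal I" for ij
    using that subD by (intro pair) auto
  have int1: "integrable M (\<lambda>\<omega>. \<Sum>i\<in>I. (?Y i \<omega>)\<^sup>2)"
    using I by (intro Bochner_Integration.integrable_sum single) auto
  have int2: "integrable M (\<lambda>\<omega>. \<Sum>(i, j)\<in>off_diagonal I. ?Y i \<omega> * ?Y j \<omega>)"
    using pair' unfolding split_def by (intro Bochner_Integration.integrable_sum) blast
  show "integrable M (\<lambda>\<omega>. (\<Sum>i\<in>I. ?Y i \<omega>)\<^sup>2)"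
    unfolding sum_square_off_diagonal[OF finI] using int1 int2 by simp
  have "expectation (\<lambda>\<omega>. (\<Sum>i\<in>I. ?Y i \<omega>)\<^sup>2)
      = expectation (\<lambda>\<omega>. \<Sum>i\<in>I. (?Y i \<omega>)\<^sup>2) + expectation (\<lambda>\<omega>. \<Sum>(i, j)\<in>off_diagonal I. ?Y i \<omega> * ?Y j \<omega>)"
    unfolding sum_square_off_diagonal[OF finI] using int1 int2 by simp
  also have "expectation (\<lambda>\<omega>. \<Sum>i\<in>I. (?Y i \<omega>)\<^sup>2) \<le> m"
  proof -
    \<comment> \<open>A pathwise bound: \<pi> maps \<open>I\<close> injectively into
      \<open>Gen r\<close>.\<close>
    have "expectation (\<lambda>\<omega>. \<Sum>i\<in>I. (?Y i \<omega>)\<^sup>2) \<le> expectation (\<lambda>\<omega>. \<Sum>a\<in>Gen r. (u (X a \<omega>))\<^sup>2)"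
    proof (rule integral_mono[OF int1])
      show "integrable M (\<lambda>\<omega>. \<Sum>a\<in>Gen r. (u (X a \<omega>))\<^sup>2)"
        using sq by simp
      fix \<omega> assume \<omega>: "\<omega> \<in> space M"
      have "(\<Sum>i\<in>I. (?Y i \<omega>)\<^sup>2) = (\<Sum>a\<in>\<pi> \<omega> ` I. (u (X a \<omega>))\<^sup>2)"
        using \<pi>_inj[OF \<omega>] by (subst sum.reindex) (auto simp: inj_on_def)
      also have "\<dots> \<le> (\<Sum>a\<in>Gen r. (u (X a \<omega>))\<^sup>2)"
        using I \<pi>_Gen[OF \<omega>] by (intro sum_mono2) auto
      finally show "(\<Sum>i\<in>I. (?Y i \<omega>)\<^sup>2) \<le> (\<Sum>a\<in>Gen r. (u (X a \<omega>))\<^sup>2)" .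
    qed
    also have "\<dots> = m" using sq by (simp add: m_def)
    finally show ?thesis .
  qed
  also have "expectation (\<lambda>\<omega>. \<Sum>(i, j)\<in>off_diagonal I. ?Y i \<omega> * ?Y j \<omega>) \<le> T"
  proof -
    have "expectation (\<lambda>\<omega>. \<Sum>(i, j)\<in>off_diagonal I. ?Y i \<omega> * ?Y j \<omega>)
        = (\<Sum>ij\<in>off_diagonal I. (T - m) / card D)"
      unfolding split_def using pair' by (simp add: Bochner_Integration.integral_sum)
    also have "\<dots> = (card (off_diagonal I) / card D) * (T - m)"
      by simp
    \<comment> \<open>\<open>T - m\<close> may be negative, so \<open>m\<close> is dropped before
      the ratio is compared with \<open>1\<close>.\<close>
    also have "\<dots> \<le> (card (off_diagonal I) / card D) * T"
      using m0 by (intro mult_left_mono) auto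
    also have "\<dots> \<le> 1 * T"
    proof (intro mult_right_mono T0)
      have "card (off_diagonal I) \<le> card D"
        using subD by (intro card_mono) (auto simp: D_def)
      \<comment> \<open>For \<open>r = 0\<close> both sets are empty and the quotient is
        \<open>0\<close>.\<close>
      then show "card (off_diagonal I) / card D \<le> 1"
        by (auto simp: divide_le_eq_1)
    qed
    finally show ?thesis by simp
  qed
  finally show "expectation (\<lambda>\<omega>. (\<Sum>i\<in>I. ?Y i \<omega>)\<^sup>2) \<le> m + T" by simp
qed

end

section \<open>Choice of constants and conclusion\<close>

theorem theorem2p4:
  fixes M :: "'w measure"
    and X :: "nat \<Rightarrow> 'w \<Rightarrow> 's::metric_space"
    and \<pi> :: "'w \<Rightarrow> nat \<Rightarrow> nat"
    and \<nu> :: "'s measure"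
    and P :: "'s \<Rightarrow> ('s \<times> 's) measure"
    and F :: "('s \<Rightarrow> real) set"
    and \<mu> :: "'s measure"
    and \<alpha> :: real
    and f :: "'s \<Rightarrow> real"
  assumes M: "prob_space M"
    and P_kernel: "P \<in> borel \<rightarrow>\<^sub>M prob_algebra (borel \<Otimes>\<^sub>M borel)"
    and BMC: "is_BMC M X \<nu> P"
    and perm: "is_unif_level_perm M \<pi>"
    and indep: "prob_space.indep_set M
                  {(\<lambda>\<omega>. \<pi> \<omega>) -` A \<inter> space M | A. A \<in> sets (Pi\<^sub>M UNIV (\<lambda>_. count_space UNIV))}
                  {(\<lambda>\<omega> n. X n \<omega>) -` B \<inter> space M | B. B \<in> sets (Pi\<^sub>M UNIV (\<lambda>_. borel))}"
    and F_meas: "F \<subseteq> borel_measurable borel"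
    and F_zero: "(\<lambda>_. 0) \<in> F"
    and F_add: "\<And>g h. g \<in> F \<Longrightarrow> h \<in> F \<Longrightarrow> (\<lambda>x. g x + h x) \<in> F"
    and F_smult: "\<And>c g. g \<in> F \<Longrightarrow> (\<lambda>x. c * g x) \<in> F"
    and F_i: "\<And>c. (\<lambda>_. c) \<in> F"
    and F_ii: "\<And>g. g \<in> F \<Longrightarrow> (\<lambda>x. (g x)\<^sup>2) \<in> F"
    and F_iii: "\<And>x g h. g \<in> F \<Longrightarrow> h \<in> F \<Longrightarrow>
                  integrable (P x) (\<lambda>yz. g (fst yz) * h (snd yz)) \<and>
                  (\<lambda>x'. \<integral>yz. g (fst yz) * h (snd yz) \<partial>(P x')) \<in> F"
    and mu: "prob_space \<mu>" "sets \<mu> = sets borel"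
    and F_iv: "\<And>g. g \<in> F \<Longrightarrow> integrable \<mu> g"
    and F_iv_lim: "\<And>x g. g \<in> F \<Longrightarrow> (\<lambda>r. Qpow P r g x) \<longlonglongrightarrow> (\<integral>y. g y \<partial>\<mu>)"
    and F_v: "\<And>g. g \<in> F \<Longrightarrow> \<exists>h\<in>F. \<forall>r x. \<bar>Qpow P r g x\<bar> \<le> h x"
    and F_vi: "\<And>g. g \<in> F \<Longrightarrow> integrable \<nu> g"
    and alpha: "0 < \<alpha>" "\<alpha> < root 4 8 / 2"
    and H1: "\<And>g. g \<in> F \<Longrightarrow> (\<integral>y. g y \<partial>\<mu>) = 0 \<Longrightarrow>
               \<exists>h\<in>F. \<forall>r x. \<bar>Qpow P r g x\<bar> \<le> \<alpha> ^ r * h x"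
    and f: "f \<in> F" "(\<integral>y. f y \<partial>\<mu>) = 0"
  shows "AE \<omega> in M. (\<lambda>n. (\<Sum>i=1..n. f (X (\<pi> \<omega> i) \<omega>)) / real n) \<longlonglongrightarrow> 0"
proof -
  interpret prob_space M by (rule M)
  interpret bifurcating_chain M X \<nu> P F
    by unfold_locales (fact P_kernel BMC F_meas F_add F_smult F_i F_ii F_iii F_vi)+
  obtain g where g: "g \<in> F" and g_decay: "\<And>r x. \<bar>Qpow P r f x\<bar> \<le> \<alpha> ^ r * g x"
    using H1[OF f] by blast
  \<comment> \<open>Condition (v) dominates all iterates of \<open>u^2\<close> by one function,
    whose \<nu>-mean is finite by (vi).\<close>
  have bounded_means: "\<exists>C\<ge>0. \<forall>r. (\<integral>x. (Qop ^^ r) (\<lambda>x. (u x)\<^sup>2) x \<partial>\<nu>) \<le> C" if u: "u \<in> F" for u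
  proof -
    obtain h where h: "h \<in> F" "\<And>r x. \<bar>Qpow P r (\<lambda>x. (u x)\<^sup>2) x\<bar> \<le> h x"
      using F_v[OF F_ii[OF u]] by blast
    have "(\<integral>x. (Qop ^^ r) (\<lambda>x. (u x)\<^sup>2) x \<partial>\<nu>) \<le> (\<integral>x. h x \<partial>\<nu>)" for r
      using h(2)[of r] by (intro integral_mono F_vi Qop_funpow_F F_ii u h(1))
        (simp add: Qpow_eq F_ii u abs_le_iff)
    moreover have "0 \<le> (\<integral>x. h x \<partial>\<nu>)"
      using h(2)[of 0] by (intro integral_nonneg_AE AE_I2) (meson abs_ge_zero order_trans)
    ultimately show ?thesis by blast
  qed
  \<comment> \<open>\<open>C\<close> bounds the sums of squares of \<open>f\<close>;
    \<open>C'\<close> is what the second-moment recursion asks of the majorant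
    \<open>g\<close>.\<close>
  obtain C where C: "0 \<le> C" "\<And>r. (\<integral>x. (Qop ^^ r) (\<lambda>x. (f x)\<^sup>2) x \<partial>\<nu>) \<le> C"
    using bounded_means[OF f(1)] by blast
  obtain C' where C': "0 \<le> C'" "\<And>r. (\<integral>x. (Qop ^^ r) (\<lambda>x. (g x)\<^sup>2) x \<partial>\<nu>) \<le> C'"
    using bounded_means[OF g] by blast
  have "\<alpha> ^ 4 < (root 4 8 / 2) ^ 4"
    using alpha by (intro power_strict_mono) auto
  then have "(\<alpha>\<^sup>2)\<^sup>2 < 1/2"
    by (simp add: power_divide)
  then have "max (\<alpha>\<^sup>2) (1/2) < sqrt (1/2)"
    unfolding max_less_iff_conj by (intro conjI real_less_rsqrt) (simp_all add: power2_eq_square)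
  then obtain b where b: "\<alpha>\<^sup>2 < b" "1/2 < b" "b < sqrt (1/2)"
    using dense by (metis max_less_iff_conj)
  \<comment> \<open>Growth \<open>sqrt 2\<close> of the number of grid points against the rate
    \<open>b\<close> of the second moments.\<close>
  define \<gamma> where "\<gamma> = sqrt 2 * b"
  have \<gamma>: "0 \<le> \<gamma>" "\<gamma> < 1"
    using b by (auto simp: \<gamma>_def real_sqrt_divide field_simps)
  define K where "K = C' * (1 + 1 / (b - \<alpha>\<^sup>2))"
  have K: "0 \<le> K" using C' b by (simp add: K_def)
  define m where "m r = (\<Sum>a\<in>Gen r. expectation (\<lambda>\<omega>. (f (X a \<omega>))\<^sup>2))" for r
  define T where "T r = expectation (\<lambda>\<omega>. (\<Sum>a\<in>Gen r. f (X a \<omega>))\<^sup>2)" for r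
  have m: "m r \<le> 2^r * C" for r
    using sum_Gen_F[OF F_ii[OF f(1)], of r] C(2)[of r] by (simp add: m_def)
  have T: "T r \<le> 4^r * (K * b^r)" for r
    using second_moment_generation[OF g C'(2) _ b(1) _ f(1), of 1 r] alpha b g_decay
    by (simp add: T_def K_def Qpow_eq f mult_ac)
  define v where "v i \<omega> = f (X (\<pi> \<omega> i) \<omega>)" for i \<omega>
  \<comment> \<open>Mesh \<open>p\<close> and number of steps \<open>q\<close>; for odd
    \<open>r\<close> the surplus factor \<open>2\<close> goes to \<open>q\<close>.\<close>
  define p :: "nat \<Rightarrow> nat" where "p r = 2 ^ (r div 2)" for r
  define q :: "nat \<Rightarrow> nat" where "q r = 2 ^ (r - r div 2)" for r
  have pq: "p r * q r = 2^r" for r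
    by (simp add: p_def q_def flip: power_add)
  have sqrt2: "(sqrt 2 ^ r)\<^sup>2 = (2::real) ^ r" for r
    by (metis power_mult mult.commute real_sqrt_pow2 zero_le_numeral)
  have p: "real (p r) \<le> sqrt 2 ^ r" for r
  proof (rule power2_le_imp_le)
    have "(real (p r))\<^sup>2 = 2 ^ (r div 2 * 2)"
      by (simp only: p_def of_nat_power of_nat_numeral power_mult)
    also have "\<dots> \<le> 2 ^ r" by (intro power_increasing) auto
    finally show "(real (p r))\<^sup>2 \<le> (sqrt 2 ^ r)\<^sup>2"
      by (simp only: sqrt2)
  qed simp
  have q: "real (q r) \<le> 2 * sqrt 2 ^ r" for r
  proof (rule power2_le_imp_le)
    have "(real (q r))\<^sup>2 = 2 ^ ((r - r div 2) * 2)"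
      by (simp only: q_def of_nat_power of_nat_numeral power_mult)
    \<comment> \<open>The exponent is at most \<open>r + 1\<close>; rounding up to
      \<open>r + 2\<close> makes the surplus the square of \<open>2\<close>.\<close>
    also have "\<dots> \<le> 2 ^ (r + 2)" by (intro power_increasing) auto
    finally show "(real (q r))\<^sup>2 \<le> (2 * sqrt 2 ^ r)\<^sup>2"
      by (simp only: power_mult_distrib sqrt2 power_add mult.commute)
  qed simp
  define S where "S r j \<omega> = (\<Sum>i\<in>{2^r..<2^r + j * p r}. v i \<omega>)\<^sup>2" for r j \<omega>
  \<comment> \<open>Half the grid bound, divided by the squared length \<open>2^r\<close> of the
    generation. The last sum runs over the chain itself, since a full generation of squares does not
    see \<pi>.\<close>
  define Z where "Z r \<omega> = ((\<Sum>j\<le>q r. S r j \<omega>) + p r * (\<Sum>a\<in>Gen r. (f (X a \<omega>))\<^sup>2)) / 4^r" for r \<omega>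
  have S: "integrable M (S r j)" "expectation (S r j) \<le> m r + T r" if "j \<le> q r" for r j
  proof -
    have "j * p r \<le> 2^r" using mult_le_mono1[OF that, of "p r"] pq[of r] by (simp add: mult.commute)
    then have "{2^r..<2^r + j * p r} \<subseteq> Gen r" by (auto simp: Gen_eq)
    from second_moment_sample[OF perm indep f(1) this]
    show "integrable M (S r j)" "expectation (S r j) \<le> m r + T r"
      by (simp_all add: S_def[abs_def] v_def m_def T_def)
  qed
  have sq: "integrable M (\<lambda>\<omega>. (f (X a \<omega>))\<^sup>2)" if "a \<in> Gen r" for a r
    using square_integrable_F_X[OF that f(1)] .
  have Z_int: "integrable M (Z r)" for r
    unfolding Z_def[abs_def] using S sq
    by (intro Bochner_Integration.integrable_divide Bochner_Integration.integrable_add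
        Bochner_Integration.integrable_sum integrable_mult_right) auto
  have Z_nonneg: "0 \<le> Z r \<omega>" for r \<omega>
    by (simp add: Z_def S_def sum_nonneg)
  \<comment> \<open>\<open>5 * C\<close> is \<open>4 * C\<close> from the grid points plus
    \<open>C\<close> from the gaps.\<close>
  have EZ: "expectation (Z r) \<le> 5 * C * (sqrt 2 / 2) ^ r + 4 * K * \<gamma> ^ r" for r
  proof -
    have "expectation (Z r) = ((\<Sum>j\<le>q r. expectation (S r j)) + p r * m r) / 4^r"
    proof -
      have "integrable M (\<lambda>\<omega>. \<Sum>j\<le>q r. S r j \<omega>)"
        and "expectation (\<lambda>\<omega>. \<Sum>j\<le>q r. S r j \<omega>) = (\<Sum>j\<le>q r. expectation (S r j))"
        using S(1) by (intro Bochner_Integration.integrable_sum Bochner_Integration.integral_sum; simp)+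
      moreover have "integrable M (\<lambda>\<omega>. \<Sum>a\<in>Gen r. (f (X a \<omega>))\<^sup>2)"
        and "expectation (\<lambda>\<omega>. \<Sum>a\<in>Gen r. (f (X a \<omega>))\<^sup>2) = m r"
        unfolding m_def using sq
        by (intro Bochner_Integration.integrable_sum Bochner_Integration.integral_sum; simp)+
      ultimately show ?thesis
        by (simp add: Z_def[abs_def])
    qed
    also have "\<dots> \<le> ((\<Sum>j\<le>q r. m r + T r) + p r * m r) / 4^r"
      using S(2) by (intro divide_right_mono add_right_mono sum_mono) auto
    also have "\<dots> = ((real (q r) + 1) * (m r + T r) + p r * m r) / 4^r"
      by (simp add: algebra_simps)
    also have "\<dots> \<le> ((4 * sqrt 2 ^ r) * (2^r * C + 4^r * (K * b^r)) + sqrt 2 ^ r * (2^r * C)) / 4^r"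
    proof (intro divide_right_mono add_mono mult_mono m T p)
      have "1 \<le> sqrt 2 ^ r" by (intro one_le_power) simp
      \<comment> \<open>The \<open>1\<close> counts the grid point \<open>j = 0\<close>.\<close>
      then show "real (q r) + 1 \<le> 4 * sqrt 2 ^ r"
        using q[of r] by linarith
    qed (use C K b in \<open>simp_all add: m_def T_def sum_nonneg\<close>)
    also have "\<dots> = 5 * C * (sqrt 2 / 2) ^ r + 4 * K * \<gamma> ^ r"
    proof -
      have "(4::real) ^ r = 2^r * 2^r" by (simp flip: power_mult_distrib)
      then show ?thesis
        by (simp add: \<gamma>_def power_divide power_mult_distrib field_simps)
    qed
    finally show ?thesis .
  qed
  have "summable (\<lambda>r. expectation (Z r))"
  proof (rule summable_comparison_test')
    have "sqrt 2 / 2 < (1::real)"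
      using real_sqrt_less_mono[of 2 4] by simp
    then show "summable (\<lambda>r. 5 * C * (sqrt 2 / 2) ^ r + 4 * K * \<gamma> ^ r)"
      using \<gamma> by (intro summable_add summable_mult summable_geometric) auto
    show "norm (expectation (Z r)) \<le> 5 * C * (sqrt 2 / 2) ^ r + 4 * K * \<gamma> ^ r" if "r \<ge> 0" for r
      using EZ[of r] Z_nonneg by (simp add: integral_nonneg)
  qed
  from AE_tendsto_zero_if_summable_expectation[OF Z_int Z_nonneg this] AE_space
  show ?thesis
  proof eventually_elim
    case (elim \<omega>)
    \<comment> \<open>This is the sequence \<open>s\<close> for
      \<open>dyadic_average_tendsto_zero\<close>.\<close>
    have "(\<lambda>r. sqrt (2 * Z r \<omega>)) \<longlonglongrightarrow> 0"
      using tendsto_real_sqrt[OF tendsto_mult_right_zero[OF elim(1), of 2]] by simp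
    moreover have "\<bar>\<Sum>i\<in>{2^r..<2^r+k}. v i \<omega>\<bar> \<le> 2^r * sqrt (2 * Z r \<omega>)" if k: "k \<le> 2^r" for r k
    proof -
      have "bij_betw (\<pi> \<omega>) (Gen r) (Gen r)"
        using perm elim(2) permutes_inj[of "\<pi> \<omega>"]
        by (auto simp: is_unif_level_perm_def bij_betw_def intro: inj_on_subset)
      then have "(\<Sum>i\<in>{2^r..<2^r + p r * q r}. (v i \<omega>)\<^sup>2) = (\<Sum>a\<in>Gen r. (f (X a \<omega>))\<^sup>2)"
        unfolding pq Gen_eq[symmetric] v_def by (rule sum.reindex_bij_betw)
      moreover have "0 < p r" by (simp add: p_def)
      ultimately have "(\<Sum>i\<in>{2^r..<2^r+k}. v i \<omega>)\<^sup>2 \<le> 4^r * (2 * Z r \<omega>)"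
        using partial_sum_square_le_grid[of k "p r" "q r" "\<lambda>i. v i \<omega>" "2^r"] k
        by (simp add: pq Z_def S_def)
      then have "\<bar>\<Sum>i\<in>{2^r..<2^r+k}. v i \<omega>\<bar> \<le> sqrt (4^r * (2 * Z r \<omega>))"
        by (intro real_le_rsqrt) (simp only: power2_abs)
      then show ?thesis by (simp add: real_sqrt_mult real_sqrt_power)
    qed
    ultimately show ?case
      using dyadic_average_tendsto_zero[of _ "\<lambda>i. v i \<omega>"] by (simp add: v_def)
  qed
qed

end
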